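(* Let $k$ be a field with algebraic closure $\bar k$, $n\ge1$, $a_0,\ldots,a_{n-1}\in k$ with $a_0=0$, and $L(y)=y^{(n)}+\sum_{i=0}^{n-1}a_iy^{(i)}$. Let $\alpha_1,\ldots,\alpha_r\in\bar k$ be the distinct roots of $\lambda^n+\sum_{i=0}^{n-1}a_i\lambda^i$, with multiplicities $m_1+1,\ldots,m_r+1$ (so exactly one $\alpha_i$ equals $0$). Put $z_{j,t}=x^{[j]}e^{\alpha_tx}\in H\bar k$ for $1\le t\le r$, $0\le j\le m_t$, and $Z=(z_{0,1},\ldots,z_{m_1,1},\ldots,z_{0,r},\ldots,z_{m_r,r})$. Let $V=\{y\in Hk\mid L(y)=0\}$, let $y_1,\ldots,y_n$ be a $k$-basis of $V$, $Y=(y_1,\ldots,y_n)$, and let $T\in GL(n,\bar k)$ satisfy $YT=Z$. Let $u_t\in M(m_t+1,\bar k)$ be the nilpotent matrix with $1$'s on the superdiagonal and $0$ elsewhere ($u_t=0$ if $m_t=0$). Define $\Gamma_t=C_{\bar k}(u_t)\cap U(m_t+1,\bar k)$ if $\alpha_t=0$, and $\Gamma_t=C_{\bar k}(u_t)$ if $\alpha_t\neq0$. Then the map $\sigma\mapsto C_\sigma$, defined by $\sigma(Y)=YC_\sigma$, is a group isomorphism $$G(V|k)\;\cong\;GL(n,k)\cap T\,\{\mathrm{diag}(g_1,\ldots,g_r)\mid g_t\in\Gamma_t\}\,T^{-1},$$ where $\mathrm{diag}(g_1,\ldots,g_r)$ denotes the block-diagonal matrix with diagonal blocks $g_1,\l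dots,g_r$.
   Context: For a field $F$, $HF$ is the ring of Hurwitz series: all sequences $(a_n)_{n\in\mathbb N}$ in $F$, with termwise addition and product $(a_n)\cdot(b_n)=(c_n)$, where $c_n=\sum_{j=0}^n\binom{n}{j}a_jb_{n-j}$. It has derivation $\partial(a_0,a_1,\ldots)=(a_1,a_2,\ldots)$, written $y\mapsto y'$, with $y^{(i)}=\partial^iy$; it is applied entrywise to row vectors. $Hk\subseteq H\bar k$ naturally. Elements $c\in F$ are identified with $(c,0,0,\ldots)$. For $\beta\in F$, $e^{\beta x}=(1,\beta,\beta^2,\ldots)$. The divided powers are $x^{[i]}=(\delta^i_n)_{n\in\mathbb N}$. The entries of $Z$ form a $\bar k$-basis of the solution space of $L$ in $H\bar k$, and $Y$ is also such a basis, so $T$ exists. $G(V|k)$ denotes the group of $k$-differential automorphisms of $V$: the $k$-linear bijections $\sigma:V\to V$ with $\sigma(v')=\sigma(v)'$ for all $v\in V$ and $\sigma(c)=c$ for all $c\in k\cap V$. For $A\in M(m,F)$, $C_F(A)=\{T\in GL(m,F)\mid AT=TA\}$. $U(m,F)$ is the group of upper triangular matrices in $GL(m,F)$ with all diagonal entries $1$. *)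

theory Defs
  imports "Jordan_Normal_Form.Matrix" "HOL-Computational_Algebra.Polynomial" "HOL-Library.FuncSet"
begin

definition is_subfield :: "'K::field set \<Rightarrow> bool" where
  "is_subfield k \<longleftrightarrow> 0 \<in> k \<and> 1 \<in> k \<and>
     (\<forall>x\<in>k. \<forall>y\<in>k. x + y \<in> k \<and> x * y \<in> k) \<and>
     (\<forall>x\<in>k. - x \<in> k) \<and> (\<forall>x\<in>k. x \<noteq> 0 \<longrightarrow> inverse x \<in> k)"

definition is_algebraic_closure_of :: "'K::field set \<Rightarrow> bool" where
  "is_algebraic_closure_of k \<longleftrightarrow> is_subfield k \<and>
     (\<forall>p :: 'K poly. degree p > 0 \<longrightarrow> (\<exists>x. poly p x = 0)) \<and>
     (\<forall>x :: 'K. \<exists>p :: 'K poly. p \<noteq> 0 \<and> (\<forall>i. coeff p i \<in> k) \<and> poly p x = 0)"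

type_synonym 'a hurwitz = "nat \<Rightarrow> 'a"

definition hadd :: "'a::field hurwitz \<Rightarrow> 'a hurwitz \<Rightarrow> 'a hurwitz" where
  "hadd y z = (\<lambda>n. y n + z n)"

definition hmult :: "'a::field hurwitz \<Rightarrow> 'a hurwitz \<Rightarrow> 'a hurwitz" where
  "hmult y z = (\<lambda>n. \<Sum>j\<le>n. of_nat (n choose j) * y j * z (n - j))"

definition hconst :: "'a::field \<Rightarrow> 'a hurwitz" where
  "hconst c = (\<lambda>n. if n = 0 then c else 0)"

definition hderiv :: "'a::field hurwitz \<Rightarrow> 'a hurwitz" where
  "hderiv y = (\<lambda>n. y (Suc n))"

definition hexp :: "'a::field \<Rightarrow> 'a hurwitz" where
  "hexp \<beta> = (\<lambda>n. \<beta> ^ n)"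

definition hdivpow :: "nat \<Rightarrow> 'a::field hurwitz" where
  "hdivpow i = (\<lambda>n. if n = i then 1 else 0)"

definition hsum :: "('i \<Rightarrow> 'a::field hurwitz) \<Rightarrow> 'i set \<Rightarrow> 'a hurwitz" where
  "hsum f I = (\<lambda>q. \<Sum>i\<in>I. f i q)"

definition Lop :: "nat \<Rightarrow> (nat \<Rightarrow> 'a::field) \<Rightarrow> 'a hurwitz \<Rightarrow> 'a hurwitz" where
  "Lop n a y = hadd ((hderiv ^^ n) y) (hsum (\<lambda>i. hmult (hconst (a i)) ((hderiv ^^ i) y)) {..<n})"

definition charpoly :: "nat \<Rightarrow> (nat \<Rightarrow> 'a::field) \<Rightarrow> 'a poly" where
  "charpoly n a = monom 1 n + (\<Sum>i<n. monom (a i) i)"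

definition solV :: "'K::field set \<Rightarrow> nat \<Rightarrow> (nat \<Rightarrow> 'K) \<Rightarrow> 'K hurwitz set" where
  "solV k n a = {y. (\<forall>q. y q \<in> k) \<and> Lop n a y = (\<lambda>_. 0)}"

definition is_basis_over :: "'K::field set \<Rightarrow> 'K hurwitz set \<Rightarrow> nat \<Rightarrow> (nat \<Rightarrow> 'K hurwitz) \<Rightarrow> bool" where
  "is_basis_over k V n Y \<longleftrightarrow> (\<forall>i<n. Y i \<in> V) \<and>
     (\<forall>c. (\<forall>i<n. c i \<in> k) \<longrightarrow> hsum (\<lambda>i. hmult (hconst (c i)) (Y i)) {..<n} = (\<lambda>_. 0) \<longrightarrow> (\<forall>i<n. c i = 0)) \<and>
     (\<forall>v\<in>V. \<exists>c. (\<forall>i<n. c i \<in> k) \<and> v = hsum (\<lambda>i. hmult (hconst (c i)) (Y i)) {..<n})"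

definition diff_aut_set :: "'K::field set \<Rightarrow> 'K hurwitz set \<Rightarrow> ('K hurwitz \<Rightarrow> 'K hurwitz) set" where
  "diff_aut_set k V = {\<sigma>. \<sigma> \<in> extensional V \<and> bij_betw \<sigma> V V \<and>
     (\<forall>u\<in>V. \<forall>v\<in>V. \<sigma> (hadd u v) = hadd (\<sigma> u) (\<sigma> v)) \<and>
     (\<forall>c\<in>k. \<forall>v\<in>V. \<sigma> (hmult (hconst c) v) = hmult (hconst c) (\<sigma> v)) \<and>
     (\<forall>v\<in>V. \<sigma> (hderiv v) = hderiv (\<sigma> v)) \<and>
     (\<forall>c\<in>k. hconst c \<in> V \<longrightarrow> \<sigma> (hconst c) = hconst c)}"

definition diff_aut_group :: "'K::field set \<Rightarrow> 'K hurwitz set \<Rightarrow> ('K hurwitz \<Rightarrow> 'K hurwitz) monoid" where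
  "diff_aut_group k V = \<lparr>carrier = diff_aut_set k V, monoid.mult = (\<lambda>\<sigma> \<tau>. compose V \<sigma> \<tau>),
     one = restrict id V\<rparr>"

definition Cmat :: "'K::field set \<Rightarrow> nat \<Rightarrow> (nat \<Rightarrow> 'K hurwitz) \<Rightarrow> ('K hurwitz \<Rightarrow> 'K hurwitz) \<Rightarrow> 'K mat" where
  "Cmat k n Y \<sigma> = (THE C. C \<in> carrier_mat n n \<and> (\<forall>i<n. \<forall>j<n. C $$ (i,j) \<in> k) \<and>
      (\<forall>j<n. \<sigma> (Y j) = hsum (\<lambda>i. hmult (hconst (C $$ (i,j))) (Y i)) {..<n}))"

definition GLm :: "nat \<Rightarrow> 'a::field set \<Rightarrow> 'a mat set" where
  "GLm m S = {A. A \<in> carrier_mat m m \<and> (\<forall>i<m. \<forall>j<m. A $$ (i,j) \<in> S) \<and>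
     (\<exists>B. B \<in> carrier_mat m m \<and> (\<forall>i<m. \<forall>j<m. B $$ (i,j) \<in> S) \<and> A * B = 1\<^sub>m m \<and> B * A = 1\<^sub>m m)}"

definition inv_matrix :: "nat \<Rightarrow> 'a::field mat \<Rightarrow> 'a mat" where
  "inv_matrix m A = (THE B. B \<in> carrier_mat m m \<and> A * B = 1\<^sub>m m \<and> B * A = 1\<^sub>m m)"

definition centralizer :: "nat \<Rightarrow> 'a::field mat \<Rightarrow> 'a mat set" where
  "centralizer m A = {T \<in> GLm m UNIV. A * T = T * A}"

definition unitri :: "nat \<Rightarrow> 'a::field mat set" where
  "unitri m = {T \<in> GLm m UNIV. (\<forall>i<m. \<forall>j<m. j < i \<longrightarrow> T $$ (i,j) = 0) \<and> (\<forall>i<m. T $$ (i,i) = 1)}"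

definition nilp_u :: "nat \<Rightarrow> 'a::field mat" where
  "nilp_u m = mat m m (\<lambda>(i,j). if j = Suc i then 1 else 0)"

definition Gamma :: "nat \<Rightarrow> 'a::field \<Rightarrow> 'a mat set" where
  "Gamma m \<alpha> = (if \<alpha> = 0 then centralizer m (nilp_u m) \<inter> unitri m else centralizer m (nilp_u m))"

definition target_group :: "'K::field set \<Rightarrow> nat \<Rightarrow> 'K mat \<Rightarrow> nat \<Rightarrow> (nat \<Rightarrow> nat) \<Rightarrow> (nat \<Rightarrow> 'K) \<Rightarrow> 'K mat monoid" where
  "target_group k n T r m \<alpha> = \<lparr>carrier = GLm n k \<inter>
      {T * diag_block_mat gs * inv_matrix n T | gs. length gs = r \<and> (\<forall>t<r. gs ! t \<in> Gamma (Suc (m t)) (\<alpha> t))},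
    monoid.mult = (*), one = 1\<^sub>m n\<rparr>"

end

theory Submission
  imports Defs "Jordan_Normal_Form.Jordan_Normal_Form"
begin

text \<open>In the basis \<open>Z = Y T\<close> of exponential solutions the derivation has the block Jordan matrix \<open>J\<close>
  with blocks \<open>J\<^sub>t = \<alpha>\<^sub>t + u\<^sub>t\<close>, so in the basis \<open>Y\<close> it has the matrix \<open>A = T J T\<^sup>-\<^sup>1\<close>. A matrix \<open>C\<close> over
  \<open>k\<close> describes an automorphism iff it is invertible, commutes with \<open>A\<close> and fixes the coordinate vector
  of \<open>1\<close>. For \<open>g = T\<^sup>-\<^sup>1 C T\<close> the second condition says \<open>J\<^sub>s g\<^sub>s\<^sub>t = g\<^sub>s\<^sub>t J\<^sub>t\<close> for all blocks of \<open>g\<close>: as the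
  eigenvalues are distinct, \<open>g\<close> is block diagonal with blocks commuting with \<open>u\<^sub>t\<close>, hence upper
  triangular Toeplitz. Since \<open>1 = z\<^sub>0\<^sub>,\<^sub>t\<close> for the \<open>t\<close> with \<open>\<alpha>\<^sub>t = 0\<close>, the third condition says that the
  block of this \<open>t\<close> has first column \<open>e\<^sub>0\<close>, which for a Toeplitz matrix means being unitriangular.\<close>

section \<open>Invertible matrices\<close>

lemma mult_mat_unit_vec:
  fixes A :: "'a::semiring_1 mat"
  assumes "A \<in> carrier_mat m n" "j < n"
  shows "A *\<^sub>v unit_vec n j = col A j"
  using assms by (intro eq_vecI) auto

lemma eq_mat_unit_vecI:
  fixes A B :: "'a::semiring_1 mat"
  assumes "A \<in> carrier_mat m n" "B \<in> carrier_mat m n"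
    and "\<And>j. j < n \<Longrightarrow> A *\<^sub>v unit_vec n j = B *\<^sub>v unit_vec n j"
  shows "A = B"
  using assms by (intro mat_col_eqI) (auto simp: mult_mat_unit_vec)

lemma GLm_carrier: "A \<in> GLm n S \<Longrightarrow> A \<in> carrier_mat n n"
  by (simp add: GLm_def)

lemma GLm_subset_UNIV: "GLm n S \<subseteq> GLm n UNIV"
  by (auto simp: GLm_def)

lemma GLm_UNIV_iff_det: "A \<in> GLm n UNIV \<longleftrightarrow> A \<in> carrier_mat n n \<and> det A \<noteq> 0"
proof
  assume "A \<in> GLm n UNIV"
  then obtain B where A: "A \<in> carrier_mat n n" and B: "B \<in> carrier_mat n n" and "A * B = 1\<^sub>m n"
    by (auto simp: GLm_def)
  then have "det A * det B = 1" by (metis det_mult det_one)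
  then show "A \<in> carrier_mat n n \<and> det A \<noteq> 0" using A by auto
next
  assume "A \<in> carrier_mat n n \<and> det A \<noteq> 0"
  then have "A \<in> Units (ring_mat TYPE('a) n ())" and "A \<in> carrier_mat n n"
    by (auto intro: det_non_zero_imp_unit)
  then show "A \<in> GLm n UNIV" by (auto simp: Units_def ring_mat_def GLm_def)
qed

lemma inv_matrix_eqI:
  assumes P: "P \<in> carrier_mat n n" and Q: "Q \<in> carrier_mat n n"
    and PQ: "P * Q = 1\<^sub>m n" and QP: "Q * P = 1\<^sub>m n"
  shows "inv_matrix n P = Q"
  unfolding inv_matrix_def
proof (rule the_equality)
  fix B assume B: "B \<in> carrier_mat n n \<and> P * B = 1\<^sub>m n \<and> B * P = 1\<^sub>m n"
  then have "B = B * (P * Q)" using PQ right_mult_one_mat[of B n n] by simp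
  also have "\<dots> = B * P * Q" using B assoc_mult_mat[OF _ P Q, of B n] by simp
  finally show "B = Q" using B Q by simp
qed (use assms in simp)

lemma inv_matrix_GLm:
  assumes "A \<in> GLm n S"
  shows inv_matrix_carrier: "inv_matrix n A \<in> carrier_mat n n"
    and mult_inv_matrix: "A * inv_matrix n A = 1\<^sub>m n"
    and inv_matrix_mult: "inv_matrix n A * A = 1\<^sub>m n"
proof -
  obtain B where "B \<in> carrier_mat n n" "A * B = 1\<^sub>m n" "B * A = 1\<^sub>m n"
    using assms by (auto simp: GLm_def)
  moreover from this have "inv_matrix n A = B"
    using assms by (auto simp: GLm_def intro: inv_matrix_eqI)
  ultimately show "inv_matrix n A \<in> carrier_mat n n" "A * inv_matrix n A = 1\<^sub>m n"
    "inv_matrix n A * A = 1\<^sub>m n" by simp_all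
qed

lemma inv_matrix_mem_GLm: "A \<in> GLm n S \<Longrightarrow> inv_matrix n A \<in> GLm n UNIV"
  using inv_matrix_GLm[of A n S] by (auto simp: GLm_def)

lemma inv_matrix_inv_matrix: "A \<in> GLm n S \<Longrightarrow> inv_matrix n (inv_matrix n A) = A"
  using inv_matrix_GLm[of A n S] GLm_carrier[of A n S] by (intro inv_matrix_eqI)

lemma GLm_mult_mat_vec_cancel:
  assumes A: "A \<in> GLm n S" and v: "v \<in> carrier_vec n" and w: "w \<in> carrier_vec n"
  shows "A *\<^sub>v v = A *\<^sub>v w \<longleftrightarrow> v = w"
proof
  assume "A *\<^sub>v v = A *\<^sub>v w"
  then have "inv_matrix n A *\<^sub>v (A *\<^sub>v v) = inv_matrix n A *\<^sub>v (A *\<^sub>v w)" by simp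
  then show "v = w"
    using v w inv_matrix_mult[OF A]
    by (simp flip: assoc_mult_mat_vec[OF inv_matrix_carrier[OF A] GLm_carrier[OF A]])
qed simp

lemma mult_mem_GLm_UNIV:
  assumes "A \<in> GLm n UNIV" "B \<in> GLm n UNIV"
  shows "A * B \<in> GLm n UNIV"
  using assms det_mult[of A n B] by (auto simp: GLm_UNIV_iff_det)

definition vecs_over :: "'a set \<Rightarrow> nat \<Rightarrow> 'a vec set" where
  "vecs_over S n = {v \<in> carrier_vec n. \<forall>i<n. v $ i \<in> S}"

definition mats_over :: "'a set \<Rightarrow> nat \<Rightarrow> 'a mat set" where
  "mats_over S n = {A \<in> carrier_mat n n. \<forall>i<n. \<forall>j<n. A $$ (i, j) \<in> S}"

lemma vecs_over_carrier: "v \<in> vecs_over S n \<Longrightarrow> v \<in> carrier_vec n"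
  by (simp add: vecs_over_def)

lemma mats_over_carrier: "A \<in> mats_over S n \<Longrightarrow> A \<in> carrier_mat n n"
  by (simp add: mats_over_def)

lemma GLm_subset_mats_over: "GLm n S \<subseteq> mats_over S n"
  by (auto simp: GLm_def mats_over_def)

lemma mem_mats_over_iff_col:
  assumes "A \<in> carrier_mat n n"
  shows "A \<in> mats_over S n \<longleftrightarrow> (\<forall>j<n. col A j \<in> vecs_over S n)"
  using assms by (auto simp: mats_over_def vecs_over_def)

lemma exists_mat_over_cols:
  assumes "\<And>j. j < n \<Longrightarrow> \<exists>c\<in>vecs_over S n. P j c"
  obtains B where "B \<in> mats_over S n" "\<And>j. j < n \<Longrightarrow> P j (col B j)"
proof -
  obtain c where c: "\<And>j. j < n \<Longrightarrow> c j \<in> vecs_over S n \<and> P j (c j)" using assms by metis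
  let ?B = "mat_of_cols n (map c [0..<n])"
  have "?B \<in> carrier_mat n n" by (rule carrier_matI) simp_all
  moreover have "col ?B j = c j" if "j < n" for j
    using c[OF that] that by (intro eq_vecI) (auto simp: mat_of_cols_index vecs_over_def)
  ultimately show ?thesis using that[of ?B] c by (simp add: mem_mats_over_iff_col)
qed

lemma unit_vecs_image_imp_GLm:
  assumes A: "A \<in> mats_over S n"
    and image: "\<And>j. j < n \<Longrightarrow> \<exists>c\<in>vecs_over S n. A *\<^sub>v c = unit_vec n j"
  shows "A \<in> GLm n S"
proof -
  obtain B where B: "B \<in> mats_over S n" and col_B: "\<And>j. j < n \<Longrightarrow> A *\<^sub>v col B j = unit_vec n j"
    using exists_mat_over_cols[of n S "\<lambda>j c. A *\<^sub>v c = unit_vec n j"] image by blast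
  note carriers = mats_over_carrier[OF A] mats_over_carrier[OF B]
  have "A * B = 1\<^sub>m n"
    using carriers col_B by (intro mat_col_eqI) (simp_all add: col_mult2[OF carriers] del: col_mult)
  moreover from this have "B * A = 1\<^sub>m n"
    by (rule mat_mult_left_right_inverse[OF carriers])
  ultimately show ?thesis using A B by (auto simp: GLm_def mats_over_def)
qed

definition centralizer_stabilizer :: "nat \<Rightarrow> 'a::field mat \<Rightarrow> 'a vec \<Rightarrow> 'a mat set" where
  "centralizer_stabilizer n A w = {C \<in> centralizer n A. C *\<^sub>v w = w}"

lemma conjugate_inv_matrix_cancel:
  assumes P: "P \<in> GLm n S" and C: "C \<in> carrier_mat n n"
  shows "P * (inv_matrix n P * C * P) * inv_matrix n P = C"
proof -
  note [simp] = assoc_mult_mat[of _ n n _ n _ n] mult_carrier_mat[of _ n n _ n]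
  note carriers = GLm_carrier[OF P] inv_matrix_carrier[OF P]
  have "P * (inv_matrix n P * M) = M" if "M \<in> carrier_mat n n" for M
    using assoc_mult_mat[OF carriers that] mult_inv_matrix[OF P] that by simp
  then show ?thesis using C carriers mult_inv_matrix[OF P] by simp
qed

lemma conjugate_mem_centralizer_stabilizer:
  assumes P: "P \<in> GLm n UNIV" and A: "A \<in> carrier_mat n n" and v: "v \<in> carrier_vec n"
    and C: "C \<in> centralizer_stabilizer n A v"
  defines "Q \<equiv> inv_matrix n P"
  shows "P * C * Q \<in> centralizer_stabilizer n (P * A * Q) (P *\<^sub>v v)"
proof -
  have carriers: "P \<in> carrier_mat n n" "Q \<in> carrier_mat n n" "C \<in> carrier_mat n n"
    using P C inv_matrix_carrier[OF P] GLm_carrier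
    by (auto simp: Q_def centralizer_stabilizer_def centralizer_def)
  note [simp] = assoc_mult_mat[of _ n n _ n _ n] assoc_mult_mat_vec[of _ n n _ n]
    mult_carrier_mat[of _ n n _ n] mult_mat_vec_carrier[of _ n n]
  have cancel: "Q * (P * M) = M" if "M \<in> carrier_mat n n" for M
    using assoc_mult_mat[OF carriers(2,1) that] inv_matrix_mult[OF P] that by (simp add: Q_def)
  have "(P * A * Q) * (P * C * Q) = P * (A * C) * Q" "(P * C * Q) * (P * A * Q) = P * (C * A) * Q"
    using carriers A by (simp_all add: cancel)
  moreover have "P * C * Q *\<^sub>v (P *\<^sub>v v) = P *\<^sub>v (C *\<^sub>v v)"
    using carriers v assoc_mult_mat_vec[OF carriers(2,1) v] inv_matrix_mult[OF P] by (simp add: Q_def)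
  moreover have "P * C * Q \<in> GLm n UNIV"
    using P C inv_matrix_mem_GLm[OF P] unfolding Q_def centralizer_stabilizer_def centralizer_def
    by (blast intro: mult_mem_GLm_UNIV)
  ultimately show ?thesis
    using C by (auto simp: centralizer_stabilizer_def centralizer_def)
qed

lemma centralizer_stabilizer_conjugate:
  assumes P: "P \<in> GLm n UNIV" and A: "A \<in> carrier_mat n n" and v: "v \<in> carrier_vec n"
  defines "Q \<equiv> inv_matrix n P"
  shows "centralizer_stabilizer n (P * A * Q) (P *\<^sub>v v)
    = (\<lambda>C. P * C * Q) ` centralizer_stabilizer n A v"
proof (intro equalityI subsetI)
  fix C assume C: "C \<in> centralizer_stabilizer n (P * A * Q) (P *\<^sub>v v)"
  note Q = inv_matrix_mem_GLm[OF P, folded Q_def] and inv_Q = inv_matrix_inv_matrix[OF P, folded Q_def]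
  have carriers: "P \<in> carrier_mat n n" "Q \<in> carrier_mat n n" "C \<in> carrier_mat n n"
    using P Q C GLm_carrier by (auto simp: centralizer_stabilizer_def centralizer_def)
  have "Q * C * P \<in> centralizer_stabilizer n (Q * (P * A * Q) * P) (Q *\<^sub>v (P *\<^sub>v v))"
    using conjugate_mem_centralizer_stabilizer[OF Q _ _ C] carriers A v
    by (auto simp: inv_Q mult_carrier_mat[of _ n n _ n] mult_mat_vec_carrier[of _ n n])
  moreover have "Q * (P * A * Q) * P = A"
    using conjugate_inv_matrix_cancel[OF Q A] by (simp add: inv_Q)
  moreover have "Q *\<^sub>v (P *\<^sub>v v) = v"
    using assoc_mult_mat_vec[OF carriers(2,1) v] inv_matrix_mult[OF P] v by (simp add: Q_def)
  moreover have "C = P * (Q * C * P) * Q"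
    using conjugate_inv_matrix_cancel[OF P carriers(3)] by (simp add: Q_def)
  ultimately show "C \<in> (\<lambda>C. P * C * Q) ` centralizer_stabilizer n A v" by auto
qed (use conjugate_mem_centralizer_stabilizer[OF P A v] in \<open>auto simp: Q_def\<close>)

section \<open>Block diagonal matrices\<close>

definition block_index :: "(nat \<Rightarrow> nat) \<Rightarrow> nat \<Rightarrow> nat \<Rightarrow> nat" where
  "block_index d t j = (\<Sum>s<t. d s) + j"

lemma block_index_less:
  assumes "t < r" "j < d t"
  shows "block_index d t j < (\<Sum>s<r. d s)"
proof -
  have "block_index d t j < (\<Sum>s<Suc t. d s)" using assms by (simp add: block_index_def)
  also have "\<dots> \<le> (\<Sum>s<r. d s)" using assms by (intro sum_mono2) auto
  finally show ?thesis .
qed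

lemma block_index_exists:
  assumes "p < (\<Sum>s<r. d s)"
  obtains t j where "t < r" "j < d t" "p = block_index d t j"
  using assms
proof (induction r arbitrary: thesis)
  case (Suc r)
  show ?case
  proof (cases "p < (\<Sum>s<r. d s)")
    case True
    then show ?thesis using Suc.IH Suc.prems(1) by (metis less_SucI)
  next
    case False
    then show ?thesis
      using Suc.prems(1)[of r "p - (\<Sum>s<r. d s)"] Suc.prems(2) by (auto simp: block_index_def)
  qed
qed simp

lemma all_block_index_iff:
  "(\<forall>p<(\<Sum>t<r. d t). P p) \<longleftrightarrow> (\<forall>t<r. \<forall>j<d t. P (block_index d t j))"
  by (auto intro: block_index_less elim!: block_index_exists)

lemma block_index_eq_iff:
  assumes "i < d s" "j < d t"
  shows "block_index d s i = block_index d t j \<longleftrightarrow> s = t \<and> i = j"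
proof (rule linorder_cases[of s t])
  assume "s < t"
  then have "block_index d s i < (\<Sum>u<t. d u)" using assms by (intro block_index_less)
  then show ?thesis using \<open>s < t\<close> by (simp add: block_index_def)
next
  assume "t < s"
  then have "block_index d t j < (\<Sum>u<s. d u)" using assms by (intro block_index_less)
  then show ?thesis using \<open>t < s\<close> by (simp add: block_index_def)
qed (simp add: block_index_def)

lemma sum_block_index:
  "(\<Sum>p<(\<Sum>t<r. d t). f p) = (\<Sum>t<r. \<Sum>j<d t. f (block_index d t j))"
proof (induction r)
  case (Suc r)
  let ?N = "\<Sum>t<r. d t"
  have "(\<Sum>p<?N + d r. f p) = (\<Sum>p<?N. f p) + (\<Sum>p=?N..<?N + d r. f p)"
    by (simp add: lessThan_atLeast0 sum.atLeastLessThan_concat)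
  also have "(\<Sum>p=?N..<?N + d r. f p) = (\<Sum>j<d r. f (block_index d r j))"
    using sum.shift_bounds_nat_ivl[of f 0 ?N "d r"]
    by (simp add: lessThan_atLeast0 block_index_def add.commute)
  finally show ?case using Suc.IH by simp
qed simp

definition square_blocks :: "(nat \<Rightarrow> nat) \<Rightarrow> 'a mat list \<Rightarrow> bool" where
  "square_blocks d As \<longleftrightarrow> (\<forall>t<length As. As ! t \<in> carrier_mat (d t) (d t))"

lemma square_blocksD: "square_blocks d As \<Longrightarrow> t < length As \<Longrightarrow> As ! t \<in> carrier_mat (d t) (d t)"
  by (simp add: square_blocks_def)

lemma square_blocks_snoc:
  "square_blocks d (As @ [A]) \<longleftrightarrow> square_blocks d As \<and> A \<in> carrier_mat (d (length As)) (d (length As))"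
  by (auto simp: square_blocks_def nth_append less_Suc_eq)

lemma diag_block_mat_carrier:
  assumes "square_blocks d As"
  shows "diag_block_mat As \<in> carrier_mat (\<Sum>t<length As. d t) (\<Sum>t<length As. d t)"
  using assms
proof (induction As rule: rev_induct)
  case (snoc A As)
  then show ?case by (auto simp: diag_block_mat_last Let_def square_blocks_snoc)
qed simp

lemma diag_block_mat_index:
  assumes "square_blocks d As" "s < length As" "t < length As" "i < d s" "j < d t"
  shows "diag_block_mat As $$ (block_index d s i, block_index d t j)
    = (if s = t then As ! t $$ (i, j) else 0)"
  using assms
proof (induction As rule: rev_induct)
  case (snoc A As)
  let ?N = "\<Sum>t<length As. d t"
  have As: "diag_block_mat As \<in> carrier_mat ?N ?N"
    and A: "A \<in> carrier_mat (d (length As)) (d (length As))"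
    using snoc.prems diag_block_mat_carrier by (auto simp: square_blocks_snoc)
  have snoc_mat: "diag_block_mat (As @ [A])
      = four_block_mat (diag_block_mat As) (0\<^sub>m ?N (d (length As))) (0\<^sub>m (d (length As)) ?N) A"
    using As A by (simp add: diag_block_mat_last Let_def)
  have last: "block_index d (length As) l = ?N + l" for l
    by (simp add: block_index_def)
  have less: "block_index d u l < ?N" if "u < length As" "l < d u" for u l
    using that by (rule block_index_less)
  consider (top_left) "s < length As" "t < length As" | (top_right) "s < length As" "t = length As"
    | (bottom_left) "s = length As" "t < length As" | (bottom_right) "s = length As" "t = length As"
    using snoc.prems by (auto simp: less_Suc_eq)
  then show ?case
  proof cases
    case top_left
    then show ?thesis
      using snoc As A by (simp add: snoc_mat less trans_less_add1 square_blocks_snoc nth_append)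
  qed (use snoc.prems As A in \<open>simp_all add: snoc_mat less last trans_less_add1 nth_append\<close>)
qed simp

lemma det_diag_block_mat:
  fixes As :: "'a::idom mat list"
  assumes "square_blocks d As"
  shows "det (diag_block_mat As) = (\<Prod>t<length As. det (As ! t))"
  using assms
proof (induction As rule: rev_induct)
  case (snoc A As)
  let ?N = "\<Sum>t<length As. d t"
  have "diag_block_mat As \<in> carrier_mat ?N ?N" "A \<in> carrier_mat (d (length As)) (d (length As))"
    using snoc.prems diag_block_mat_carrier by (auto simp: square_blocks_snoc)
  then have "det (diag_block_mat (As @ [A])) = det (diag_block_mat As) * det A"
    by (auto simp: diag_block_mat_last Let_def
        det_four_block_mat_lower_left_zero[where n = ?N and m = "d (length As)"])
  then show ?case using snoc by (simp add: square_blocks_snoc nth_append)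
qed simp

lemma diag_block_mat_mem_GLm_iff:
  assumes "square_blocks d As"
  shows "diag_block_mat As \<in> GLm (\<Sum>t<length As. d t) UNIV \<longleftrightarrow> (\<forall>t<length As. As ! t \<in> GLm (d t) UNIV)"
  using assms diag_block_mat_carrier[OF assms]
  by (auto simp: GLm_UNIV_iff_det det_diag_block_mat square_blocks_def)

definition mat_block :: "(nat \<Rightarrow> nat) \<Rightarrow> nat \<Rightarrow> nat \<Rightarrow> 'a mat \<Rightarrow> 'a mat" where
  "mat_block d s t M = mat (d s) (d t) (\<lambda>(i, j). M $$ (block_index d s i, block_index d t j))"

lemma mat_block_carrier: "mat_block d s t M \<in> carrier_mat (d s) (d t)"
  by (simp add: mat_block_def)

lemma eq_mat_iff_mat_block:
  assumes "M \<in> carrier_mat (\<Sum>t<r. d t) (\<Sum>t<r. d t)" "N \<in> carrier_mat (\<Sum>t<r. d t) (\<Sum>t<r. d t)"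
  shows "M = N \<longleftrightarrow> (\<forall>s<r. \<forall>t<r. mat_block d s t M = mat_block d s t N)"
proof
  assume blocks: "\<forall>s<r. \<forall>t<r. mat_block d s t M = mat_block d s t N"
  show "M = N"
  proof (rule eq_matI)
    fix p q assume "p < dim_row N" "q < dim_col N"
    then obtain s i t j where st: "s < r" "t < r" and ij: "i < d s" "j < d t"
      and pq: "p = block_index d s i" "q = block_index d t j"
      using assms by (auto elim!: block_index_exists)
    have "mat_block d s t M $$ (i, j) = mat_block d s t N $$ (i, j)" using blocks st by simp
    then show "M $$ (p, q) = N $$ (p, q)" using ij pq by (simp add: mat_block_def)
  qed (use assms in auto)
qed simp

lemma mat_block_diag_block_mat:
  assumes "square_blocks d As" "s < length As" "t < length As"
  shows "mat_block d s t (diag_block_mat As) = (if s = t then As ! t else 0\<^sub>m (d s) (d t))"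
  using square_blocksD[OF assms(1,3)] diag_block_mat_index[OF assms]
  by (intro eq_matI) (auto simp: mat_block_def)

lemma mat_mult_index:
  assumes "A \<in> carrier_mat nr l" "B \<in> carrier_mat l nc" "i < nr" "j < nc"
  shows "(A * B) $$ (i, j) = (\<Sum>x<l. A $$ (i, x) * B $$ (x, j))"
  using assms by (simp add: scalar_prod_def lessThan_atLeast0)

lemma sum_diag_block_mat_row_mult:
  fixes As :: "'a::semiring_0 mat list"
  assumes As: "square_blocks d As" and N: "N = (\<Sum>t<length As. d t)"
    and s: "s < length As" and i: "i < d s"
  shows "(\<Sum>p<N. diag_block_mat As $$ (block_index d s i, p) * f p)
    = (\<Sum>x<d s. As ! s $$ (i, x) * f (block_index d s x))"
proof -
  have "(\<Sum>p<N. diag_block_mat As $$ (block_index d s i, p) * f p)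
      = (\<Sum>t<length As. if t = s then \<Sum>x<d s. As ! s $$ (i, x) * f (block_index d s x) else 0)"
    unfolding N sum_block_index using s i by (intro sum.cong) (auto simp: diag_block_mat_index[OF As])
  then show ?thesis using s by simp
qed

lemma sum_mult_diag_block_mat_col:
  fixes As :: "'a::semiring_0 mat list"
  assumes As: "square_blocks d As" and N: "N = (\<Sum>t<length As. d t)"
    and t: "t < length As" and j: "j < d t"
  shows "(\<Sum>p<N. f p * diag_block_mat As $$ (p, block_index d t j))
    = (\<Sum>x<d t. f (block_index d t x) * As ! t $$ (x, j))"
proof -
  have "(\<Sum>p<N. f p * diag_block_mat As $$ (p, block_index d t j))
      = (\<Sum>s<length As. if s = t then \<Sum>x<d t. f (block_index d t x) * As ! t $$ (x, j) else 0)"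
    unfolding N sum_block_index using t j by (intro sum.cong) (auto simp: diag_block_mat_index[OF As])
  then show ?thesis using t by simp
qed

lemma mat_block_diag_block_mat_mult:
  fixes M :: "'a::semiring_0 mat"
  assumes As: "square_blocks d As" and N: "N = (\<Sum>t<length As. d t)" and M: "M \<in> carrier_mat N N"
    and s: "s < length As" and t: "t < length As"
  shows "mat_block d s t (diag_block_mat As * M) = As ! s * mat_block d s t M"
proof (rule eq_matI)
  fix i j assume "i < dim_row (As ! s * mat_block d s t M)" "j < dim_col (As ! s * mat_block d s t M)"
  then have ij: "i < d s" "j < d t" using square_blocksD[OF As s] by (auto simp: mat_block_def)
  have less: "block_index d s i < N" "block_index d t j < N"
    unfolding N using s t ij by (auto intro: block_index_less)
  show "mat_block d s t (diag_block_mat As * M) $$ (i, j) = (As ! s * mat_block d s t M) $$ (i, j)"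
    using ij mat_mult_index[OF diag_block_mat_carrier[OF As, folded N] M less]
      mat_mult_index[OF square_blocksD[OF As s] mat_block_carrier[of d s t M] ij]
    by (simp add: mat_block_def sum_diag_block_mat_row_mult[OF As N s ij(1)] del: index_mult_mat)
qed (use square_blocksD[OF As s] in \<open>auto simp: mat_block_def\<close>)

lemma mat_block_mult_diag_block_mat:
  fixes M :: "'a::semiring_0 mat"
  assumes As: "square_blocks d As" and N: "N = (\<Sum>t<length As. d t)" and M: "M \<in> carrier_mat N N"
    and s: "s < length As" and t: "t < length As"
  shows "mat_block d s t (M * diag_block_mat As) = mat_block d s t M * As ! t"
proof (rule eq_matI)
  fix i j assume "i < dim_row (mat_block d s t M * As ! t)" "j < dim_col (mat_block d s t M * As ! t)"
  then have ij: "i < d s" "j < d t" using square_blocksD[OF As t] by (auto simp: mat_block_def)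
  have less: "block_index d s i < N" "block_index d t j < N"
    unfolding N using s t ij by (auto intro: block_index_less)
  show "mat_block d s t (M * diag_block_mat As) $$ (i, j) = (mat_block d s t M * As ! t) $$ (i, j)"
    using ij mat_mult_index[OF M diag_block_mat_carrier[OF As, folded N] less]
      mat_mult_index[OF mat_block_carrier[of d s t M] square_blocksD[OF As t] ij]
    by (simp add: mat_block_def sum_mult_diag_block_mat_col[OF As N t ij(2)] del: index_mult_mat)
qed (use square_blocksD[OF As t] in \<open>auto simp: mat_block_def\<close>)

definition intertwiners :: "nat \<Rightarrow> nat \<Rightarrow> 'a::semiring_0 mat \<Rightarrow> 'a mat \<Rightarrow> 'a mat set" where
  "intertwiners p q A B = {X \<in> carrier_mat p q. A * X = X * B}"

lemma commute_diag_block_mat_iff: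
  fixes M :: "'a::semiring_0 mat"
  assumes As: "square_blocks d As" and N: "N = (\<Sum>t<length As. d t)" and M: "M \<in> carrier_mat N N"
  shows "diag_block_mat As * M = M * diag_block_mat As
    \<longleftrightarrow> (\<forall>s<length As. \<forall>t<length As. mat_block d s t M \<in> intertwiners (d s) (d t) (As ! s) (As ! t))"
proof -
  have "diag_block_mat As * M \<in> carrier_mat N N" "M * diag_block_mat As \<in> carrier_mat N N"
    using diag_block_mat_carrier[OF As, folded N] M by (auto intro: mult_carrier_mat)
  then show ?thesis
    unfolding N
    by (simp add: eq_mat_iff_mat_block intertwiners_def mat_block_carrier
        mat_block_diag_block_mat_mult[OF As N M] mat_block_mult_diag_block_mat[OF As N M])
qed

lemma commute_diag_block_mats_iff:
  fixes As Bs :: "'a::semiring_0 mat list"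
  assumes As: "square_blocks d As" and Bs: "square_blocks d Bs" and len: "length Bs = length As"
  shows "diag_block_mat As * diag_block_mat Bs = diag_block_mat Bs * diag_block_mat As
    \<longleftrightarrow> (\<forall>t<length As. As ! t * Bs ! t = Bs ! t * As ! t)"
proof -
  have "mat_block d s t (diag_block_mat Bs) \<in> intertwiners (d s) (d t) (As ! s) (As ! t)
      \<longleftrightarrow> (s = t \<longrightarrow> As ! t * Bs ! t = Bs ! t * As ! t)" if "s < length As" "t < length As" for s t
    using that len left_mult_zero_mat[OF square_blocksD[OF As that(2)]]
      right_mult_zero_mat[OF square_blocksD[OF As that(1)]]
      square_blocksD[OF Bs, of t]
    by (auto simp: intertwiners_def mat_block_diag_block_mat[OF Bs])
  then show ?thesis
    using diag_block_mat_carrier[OF Bs] len by (subst commute_diag_block_mat_iff[OF As refl]) auto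
qed

lemma commute_diag_block_mat_imp_diag:
  fixes As :: "'a::semiring_0 mat list"
  assumes As: "square_blocks d As"
    and disjoint: "\<forall>s<length As. \<forall>t<length As. s \<noteq> t \<longrightarrow>
      intertwiners (d s) (d t) (As ! s) (As ! t) \<subseteq> {0\<^sub>m (d s) (d t)}"
    and N: "N = (\<Sum>t<length As. d t)" and M: "M \<in> carrier_mat N N"
    and comm: "diag_block_mat As * M = M * diag_block_mat As"
  obtains Bs where "length Bs = length As" "square_blocks d Bs" "M = diag_block_mat Bs"
proof -
  define Bs where "Bs = map (\<lambda>t. mat_block d t t M) [0..<length As]"
  have Bs: "length Bs = length As" "square_blocks d Bs"
    by (auto simp: Bs_def square_blocks_def mat_block_carrier)
  have "mat_block d s t M = mat_block d s t (diag_block_mat Bs)"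
    if st: "s < length As" "t < length As" for s t
  proof (cases "s = t")
    case False
    have "mat_block d s t M \<in> intertwiners (d s) (d t) (As ! s) (As ! t)"
      using comm st by (simp add: commute_diag_block_mat_iff[OF As N M])
    then have "mat_block d s t M = 0\<^sub>m (d s) (d t)"
      using disjoint st False by blast
    then show ?thesis using Bs st False by (simp add: mat_block_diag_block_mat)
  qed (use Bs st in \<open>simp add: mat_block_diag_block_mat Bs_def\<close>)
  then have "M = diag_block_mat Bs"
    using M diag_block_mat_carrier[OF Bs(2)] Bs(1) N by (subst eq_mat_iff_mat_block) auto
  then show ?thesis using that Bs by blast
qed

lemma centralizer_diag_block_mat:
  fixes As :: "'a::field mat list"
  assumes As: "square_blocks d As"
    and disjoint: "\<forall>s<length As. \<forall>t<length As. s \<noteq> t \<longrightarrow>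
      intertwiners (d s) (d t) (As ! s) (As ! t) \<subseteq> {0\<^sub>m (d s) (d t)}"
  shows "centralizer (\<Sum>t<length As. d t) (diag_block_mat As) =
    diag_block_mat ` {gs. length gs = length As \<and> (\<forall>t<length As. gs ! t \<in> centralizer (d t) (As ! t))}"
proof -
  let ?N = "\<Sum>t<length As. d t"
  have diag_mem_iff: "diag_block_mat gs \<in> centralizer ?N (diag_block_mat As)
      \<longleftrightarrow> (\<forall>t<length As. gs ! t \<in> centralizer (d t) (As ! t))"
    if "length gs = length As" "square_blocks d gs" for gs
    using that As diag_block_mat_mem_GLm_iff[OF that(2)]
    by (auto simp: centralizer_def commute_diag_block_mats_iff)
  have "\<exists>gs. length gs = length As \<and> square_blocks d gs \<and> g = diag_block_mat gs"
    if "g \<in> centralizer ?N (diag_block_mat As)" for g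
  proof -
    have "g \<in> carrier_mat ?N ?N" "diag_block_mat As * g = g * diag_block_mat As"
      using that GLm_carrier by (auto simp: centralizer_def)
    then obtain gs where "length gs = length As" "square_blocks d gs" "g = diag_block_mat gs"
      by (rule commute_diag_block_mat_imp_diag[OF As disjoint refl])
    then show ?thesis by blast
  qed
  moreover have "square_blocks d gs"
    if "length gs = length As" "\<forall>t<length As. gs ! t \<in> centralizer (d t) (As ! t)" for gs
    using that by (auto simp: square_blocks_def centralizer_def dest: GLm_carrier)
  ultimately show ?thesis using diag_mem_iff by blast
qed

lemma diag_block_mat_fixes_unit_vec_iff:
  fixes As :: "'a::semiring_1 mat list"
  assumes As: "square_blocks d As" and N: "N = (\<Sum>t<length As. d t)"
    and t: "t < length As" and j: "j < d t"
  shows "diag_block_mat As *\<^sub>v unit_vec N (block_index d t j) = unit_vec N (block_index d t j)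
    \<longleftrightarrow> As ! t *\<^sub>v unit_vec (d t) j = unit_vec (d t) j"
proof -
  let ?q = "block_index d t j"
  have q: "?q < N" unfolding N by (rule block_index_less[of t _ j d, OF t j])
  have entry: "diag_block_mat As $$ (block_index d s i, ?q) = unit_vec N ?q $ block_index d s i
      \<longleftrightarrow> (s = t \<longrightarrow> As ! t $$ (i, j) = unit_vec (d t) j $ i)" if "s < length As" "i < d s" for s i
  proof -
    have "block_index d s i < N" unfolding N by (rule block_index_less[of s _ i d, OF that])
    then show ?thesis
      using diag_block_mat_index[OF As that(1) t that(2) j] block_index_eq_iff[of i d s j t] that j q
      by auto
  qed
  have "diag_block_mat As *\<^sub>v unit_vec N ?q = unit_vec N ?q
      \<longleftrightarrow> (\<forall>p<N. diag_block_mat As $$ (p, ?q) = unit_vec N ?q $ p)"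
    using diag_block_mat_carrier[OF As, folded N] q
    by (simp add: mult_mat_unit_vec vec_eq_iff)
  also have "\<dots> \<longleftrightarrow> (\<forall>s<length As. \<forall>i<d s.
      diag_block_mat As $$ (block_index d s i, ?q) = unit_vec N ?q $ block_index d s i)"
    unfolding N by (rule all_block_index_iff)
  also have "\<dots> \<longleftrightarrow> (\<forall>i<d t. As ! t $$ (i, j) = unit_vec (d t) j $ i)"
    using entry t by blast
  also have "\<dots> \<longleftrightarrow> As ! t *\<^sub>v unit_vec (d t) j = unit_vec (d t) j"
    using square_blocksD[OF As t] j by (simp add: mult_mat_unit_vec vec_eq_iff)
  finally show ?thesis .
qed

section \<open>Centralizers of Jordan matrices\<close>

lemma jordan_block_mult_index:
  fixes X :: "'a::semiring_1 mat"
  assumes X: "X \<in> carrier_mat l c" and i: "i < l" and j: "j < c"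
  shows "(jordan_block l b * X) $$ (i, j) = b * X $$ (i, j) + (if Suc i < l then X $$ (Suc i, j) else 0)"
proof -
  have "(jordan_block l b * X) $$ (i, j) = (\<Sum>x<l. jordan_block l b $$ (i, x) * X $$ (x, j))"
    by (rule mat_mult_index[OF jordan_block_carrier assms])
  also have "\<dots> = (\<Sum>x<l. (if x = i then b * X $$ (x, j) else 0) + (if x = Suc i then X $$ (x, j) else 0))"
    using i by (intro sum.cong) auto
  finally show ?thesis using i by (simp add: sum.distrib)
qed

lemma sum_mult_jordan_block_col:
  fixes f :: "nat \<Rightarrow> 'a::comm_semiring_1"
  assumes "j < l"
  shows "(\<Sum>i<l. f i * jordan_block l b $$ (i, j)) = b * f j + (if 0 < j then f (j - 1) else 0)"
proof -
  have "(\<Sum>i<l. f i * jordan_block l b $$ (i, j))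
      = (\<Sum>i<l. (if i = j then b * f i else 0) + (if i = j - 1 then if 0 < j then f i else 0 else 0))"
    using assms by (intro sum.cong) (auto simp: mult.commute)
  then show ?thesis using assms less_imp_diff_less[OF assms, of 1] by (simp add: sum.distrib)
qed

lemma mult_jordan_block_index:
  fixes X :: "'a::comm_semiring_1 mat"
  assumes X: "X \<in> carrier_mat r l" and i: "i < r" and j: "j < l"
  shows "(X * jordan_block l b) $$ (i, j) = b * X $$ (i, j) + (if 0 < j then X $$ (i, j - 1) else 0)"
  by (simp only: mat_mult_index[OF X jordan_block_carrier i j] sum_mult_jordan_block_col[OF j])

text \<open>Comparing entries expresses \<open>(\<alpha> - \<beta>) X\<^sub>i\<^sub>j\<close> through the entries below and to the left of it.\<close>

lemma intertwiners_jordan_block: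
  fixes \<alpha> \<beta> :: "'a::idom"
  assumes "\<alpha> \<noteq> \<beta>"
  shows "intertwiners p q (jordan_block p \<alpha>) (jordan_block q \<beta>) \<subseteq> {0\<^sub>m p q}"
proof
  fix X assume "X \<in> intertwiners p q (jordan_block p \<alpha>) (jordan_block q \<beta>)"
  then have X: "X \<in> carrier_mat p q" and eq: "jordan_block p \<alpha> * X = X * jordan_block q \<beta>"
    by (auto simp: intertwiners_def)
  have "X $$ (i, j) = 0" if "i < p" "j < q" for i j
    using that
  proof (induction "j + (p - i)" arbitrary: i j rule: less_induct)
    case less
    have "\<alpha> * X $$ (i, j) = (jordan_block p \<alpha> * X) $$ (i, j)"
      using less.hyps[of j "Suc i"] less.prems
      by (simp add: jordan_block_mult_index[OF X] del: index_mult_mat)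
    also have "\<dots> = \<beta> * X $$ (i, j)"
      unfolding eq using less.hyps[of "j - 1" i] less.prems
      by (simp add: mult_jordan_block_index[OF X] del: index_mult_mat)
    finally show ?case using \<open>\<alpha> \<noteq> \<beta>\<close> by simp
  qed
  then show "X \<in> {0\<^sub>m p q}" using X by auto
qed

lemma jordan_block_commute_iff:
  fixes g :: "'a::comm_ring_1 mat"
  assumes g: "g \<in> carrier_mat l l"
  shows "jordan_block l b * g = g * jordan_block l b \<longleftrightarrow>
    (\<forall>i<l. \<forall>j<l. (if Suc i < l then g $$ (Suc i, j) else 0) = (if 0 < j then g $$ (i, j - 1) else 0))"
proof -
  have "jordan_block l b * g = g * jordan_block l b \<longleftrightarrow>
      (\<forall>i<l. \<forall>j<l. (jordan_block l b * g) $$ (i, j) = (g * jordan_block l b) $$ (i, j))"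
    using g by (auto simp: mat_eq_iff)
  then show ?thesis
    using g by (simp add: jordan_block_mult_index[OF g] mult_jordan_block_index[OF g] del: index_mult_mat)
qed

lemma nilp_u_eq_jordan_block: "nilp_u l = jordan_block l 0"
  by (auto simp: nilp_u_def jordan_block_def)

lemma centralizer_jordan_block: "centralizer l (jordan_block l b) = centralizer l (nilp_u l)"
  unfolding centralizer_def nilp_u_eq_jordan_block
  by (auto simp: GLm_carrier jordan_block_commute_iff)

lemma unit_vec_fixed_imp_unitri:
  assumes g: "g \<in> centralizer l (nilp_u l)" and fixed: "g *\<^sub>v unit_vec l 0 = unit_vec l 0"
  shows "g \<in> unitri l"
proof -
  have GL: "g \<in> GLm l UNIV" and carrier: "g \<in> carrier_mat l l"
    and comm: "jordan_block l 0 * g = g * jordan_block l 0"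
    using g GLm_carrier by (auto simp: centralizer_def nilp_u_eq_jordan_block)
  have toeplitz: "g $$ (Suc i, Suc j) = g $$ (i, j)" if "Suc i < l" "Suc j < l" for i j
    using comm that unfolding jordan_block_commute_iff[OF carrier]
    by (metis Suc_lessD diff_Suc_1 zero_less_Suc)
  have "g $$ (i, j) = (if i = j then 1 else 0)" if "i < l" "j \<le> i" for i j
    using that
  proof (induction j arbitrary: i)
    case 0
    have "g $$ (i, 0) = (g *\<^sub>v unit_vec l 0) $ i" using carrier 0 by (simp add: mult_mat_unit_vec)
    then show ?case using fixed 0 by auto
  next
    case (Suc j)
    then obtain h where "i = Suc h" by (cases i) auto
    then show ?case using Suc toeplitz[of h j] by simp
  qed
  then show ?thesis using GL by (simp add: unitri_def)
qed

lemma Gamma_eq_centralizer: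
  assumes "0 < l"
  shows "Gamma l b = (if b = 0 then centralizer_stabilizer l (jordan_block l b) (unit_vec l 0)
    else centralizer l (jordan_block l b))"
proof -
  have "g *\<^sub>v unit_vec l 0 = unit_vec l 0" if g: "g \<in> unitri l" for g :: "'a mat"
  proof -
    have carrier: "g \<in> carrier_mat l l" using g GLm_carrier by (auto simp: unitri_def)
    have "g $$ (i, 0) = (if i = 0 then 1 else 0)" if "i < l" for i
      using g that by (auto simp: unitri_def)
    then show ?thesis using assms carrier by (auto simp: mult_mat_unit_vec[OF carrier] vec_eq_iff)
  qed
  then show ?thesis
    unfolding Gamma_def centralizer_stabilizer_def centralizer_jordan_block
    using unit_vec_fixed_imp_unitri by auto
qed

definition jordan_blocks :: "nat \<Rightarrow> (nat \<Rightarrow> nat) \<Rightarrow> (nat \<Rightarrow> 'a::{zero,one}) \<Rightarrow> 'a mat list" where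
  "jordan_blocks r d \<alpha> = map (\<lambda>t. jordan_block (d t) (\<alpha> t)) [0..<r]"

lemma length_jordan_blocks [simp]: "length (jordan_blocks r d \<alpha>) = r"
  by (simp add: jordan_blocks_def)

lemma nth_jordan_blocks [simp]: "t < r \<Longrightarrow> jordan_blocks r d \<alpha> ! t = jordan_block (d t) (\<alpha> t)"
  by (simp add: jordan_blocks_def)

lemma square_blocks_jordan_blocks [simp]: "square_blocks d (jordan_blocks r d \<alpha>)"
  by (simp add: square_blocks_def)

lemma centralizer_diag_jordan_blocks:
  fixes \<alpha> :: "nat \<Rightarrow> 'a::field"
  assumes "inj_on \<alpha> {..<r}"
  shows "centralizer (\<Sum>t<r. d t) (diag_block_mat (jordan_blocks r d \<alpha>))
    = diag_block_mat ` {gs. length gs = r \<and> (\<forall>t<r. gs ! t \<in> centralizer (d t) (jordan_block (d t) (\<alpha> t)))}"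
proof -
  have "\<alpha> s \<noteq> \<alpha> t" if "s < r" "t < r" "s \<noteq> t" for s t
    using assms that by (auto dest: inj_onD)
  then have "\<forall>s<r. \<forall>t<r. s \<noteq> t \<longrightarrow>
      intertwiners (d s) (d t) (jordan_blocks r d \<alpha> ! s) (jordan_blocks r d \<alpha> ! t) \<subseteq> {0\<^sub>m (d s) (d t)}"
    by (simp add: intertwiners_jordan_block)
  then have "centralizer (\<Sum>t<r. d t) (diag_block_mat (jordan_blocks r d \<alpha>))
    = diag_block_mat ` {gs. length gs = r \<and> (\<forall>t<r. gs ! t \<in> centralizer (d t) (jordan_blocks r d \<alpha> ! t))}"
    using centralizer_diag_block_mat[OF square_blocks_jordan_blocks[of d r \<alpha>]] by simp
  also have "{gs. length gs = r \<and> (\<forall>t<r. gs ! t \<in> centralizer (d t) (jordan_blocks r d \<alpha> ! t))}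
    = {gs. length gs = r \<and> (\<forall>t<r. gs ! t \<in> centralizer (d t) (jordan_block (d t) (\<alpha> t)))}"
    by auto
  finally show ?thesis .
qed

lemma centralizer_stabilizer_diag_jordan_blocks:
  fixes \<alpha> :: "nat \<Rightarrow> 'a::field"
  assumes inj: "inj_on \<alpha> {..<r}" and pos: "\<And>t. t < r \<Longrightarrow> 0 < d t" and t0: "t0 < r" "\<alpha> t0 = 0"
  defines "N \<equiv> \<Sum>t<r. d t"
  shows "centralizer_stabilizer N (diag_block_mat (jordan_blocks r d \<alpha>)) (unit_vec N (block_index d t0 0))
    = diag_block_mat ` {gs. length gs = r \<and> (\<forall>t<r. gs ! t \<in> Gamma (d t) (\<alpha> t))}"
proof -
  let ?e = "unit_vec N (block_index d t0 0) :: 'a vec"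
  have "(\<forall>t<r. gs ! t \<in> Gamma (d t) (\<alpha> t))
      \<longleftrightarrow> (\<forall>t<r. gs ! t \<in> centralizer (d t) (jordan_block (d t) (\<alpha> t))) \<and> diag_block_mat gs *\<^sub>v ?e = ?e"
    if len: "length gs = r" for gs
  proof -
    have "gs ! t \<in> Gamma (d t) (\<alpha> t) \<longleftrightarrow> gs ! t \<in> centralizer (d t) (jordan_block (d t) (\<alpha> t))
        \<and> (t = t0 \<longrightarrow> gs ! t *\<^sub>v unit_vec (d t) 0 = unit_vec (d t) 0)" if "t < r" for t
    proof -
      have "\<alpha> t = 0 \<longleftrightarrow> t = t0" using inj_on_eq_iff[OF inj, of t t0] t0 that by simp
      then show ?thesis
        by (simp add: Gamma_eq_centralizer[OF pos[OF that]] centralizer_stabilizer_def)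
    qed
    moreover have "diag_block_mat gs *\<^sub>v ?e = ?e
        \<longleftrightarrow> gs ! t0 *\<^sub>v unit_vec (d t0) 0 = unit_vec (d t0) 0"
      if "\<forall>t<r. gs ! t \<in> centralizer (d t) (jordan_block (d t) (\<alpha> t))"
    proof (rule diag_block_mat_fixes_unit_vec_iff)
      show "square_blocks d gs"
        using that len by (auto simp: square_blocks_def centralizer_def dest: GLm_carrier)
    qed (use len t0 pos in \<open>simp_all add: N_def\<close>)
    ultimately show ?thesis using t0 by blast
  qed
  then show ?thesis
    unfolding centralizer_stabilizer_def N_def centralizer_diag_jordan_blocks[OF inj] by blast
qed

lemma carrier_target_group:
  assumes T: "T \<in> GLm n UNIV" and d: "d = (\<lambda>t. Suc (m t))" and n: "n = (\<Sum>t<r. d t)"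
    and inj: "inj_on \<alpha> {..<r}" and t0: "t0 < r" "\<alpha> t0 = 0"
  shows "carrier (target_group k n T r m \<alpha>) = GLm n k \<inter> centralizer_stabilizer n
    (T * diag_block_mat (jordan_blocks r d \<alpha>) * inv_matrix n T) (T *\<^sub>v unit_vec n (block_index d t0 0))"
proof -
  have "diag_block_mat (jordan_blocks r d \<alpha>) \<in> carrier_mat n n"
    using diag_block_mat_carrier[OF square_blocks_jordan_blocks[of d r \<alpha>]] n by simp
  moreover have "centralizer_stabilizer n (diag_block_mat (jordan_blocks r d \<alpha>))
      (unit_vec n (block_index d t0 0)) = diag_block_mat ` {gs. length gs = r \<and> (\<forall>t<r. gs ! t \<in> Gamma (d t) (\<alpha> t))}"
    unfolding n
    by (rule centralizer_stabilizer_diag_jordan_blocks[where d = d, OF inj _ t0]) (simp add: d)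
  ultimately show ?thesis
    by (simp add: centralizer_stabilizer_conjugate[OF T] target_group_def d)
      (auto simp: image_iff)
qed

section \<open>Hurwitz series\<close>

lemma hmult_hconst: "hmult (hconst c) y = (\<lambda>q. c * y q)"
proof
  fix q
  have "hmult (hconst c) y q = (\<Sum>j\<le>q. if j = 0 then c * y q else 0)"
    unfolding hmult_def hconst_def by (rule sum.cong) auto
  then show "hmult (hconst c) y q = c * y q" by simp
qed

lemma funpow_hderiv: "(hderiv ^^ i) y q = y (q + i)"
  by (induction i arbitrary: q) (simp_all add: hderiv_def)

lemma Lop_apply: "Lop n a y q = y (q + n) + (\<Sum>i<n. a i * y (q + i))"
  by (simp add: Lop_def hadd_def hsum_def hmult_hconst funpow_hderiv)

lemma Lop_hadd: "Lop n a (hadd y z) = hadd (Lop n a y) (Lop n a z)"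
  by (auto simp: Lop_apply hadd_def algebra_simps sum.distrib)

lemma Lop_scale: "Lop n a (hmult (hconst c) y) = hmult (hconst c) (Lop n a y)"
  by (auto simp: Lop_apply hmult_hconst algebra_simps sum_distrib_left)

lemma Lop_hderiv: "Lop n a (hderiv y) = hderiv (Lop n a y)"
  by (auto simp: Lop_apply hderiv_def)

lemma hsum_empty: "hsum f {} = (\<lambda>_. 0)"
  by (simp add: hsum_def)

lemma hsum_insert: "finite I \<Longrightarrow> i \<notin> I \<Longrightarrow> hsum f (insert i I) = hadd (f i) (hsum f I)"
  by (simp add: hsum_def hadd_def)

definition hlincomb :: "nat \<Rightarrow> (nat \<Rightarrow> 'a::field hurwitz) \<Rightarrow> 'a vec \<Rightarrow> 'a hurwitz" where
  "hlincomb n Y v = hsum (\<lambda>i. hmult (hconst (v $ i)) (Y i)) {..<n}"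

lemma hlincomb_apply: "hlincomb n Y v q = (\<Sum>i<n. v $ i * Y i q)"
  by (simp add: hlincomb_def hsum_def hmult_hconst)

lemma hsum_eq_hlincomb: "hsum (\<lambda>i. hmult (hconst (c i)) (Y i)) {..<n} = hlincomb n Y (vec n c)"
  by (simp add: hlincomb_def hsum_def)

lemma hlincomb_col:
  assumes "C \<in> carrier_mat n l" "j < l"
  shows "hsum (\<lambda>i. hmult (hconst (C $$ (i, j))) (Y i)) {..<n} = hlincomb n Y (col C j)"
  using assms by (simp add: hlincomb_def hsum_def)

lemma hlincomb_cong: "(\<And>i. i < n \<Longrightarrow> Y i = Z i) \<Longrightarrow> hlincomb n Y v = hlincomb n Z v"
  by (simp add: hlincomb_def hsum_def)

lemma hlincomb_add:
  assumes "v \<in> carrier_vec n" "w \<in> carrier_vec n"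
  shows "hlincomb n Y (v + w) = hadd (hlincomb n Y v) (hlincomb n Y w)"
  using assms by (simp add: hlincomb_apply hadd_def distrib_right sum.distrib fun_eq_iff)

lemma hlincomb_smult:
  assumes "v \<in> carrier_vec n"
  shows "hlincomb n Y (c \<cdot>\<^sub>v v) = hmult (hconst c) (hlincomb n Y v)"
  using assms by (simp add: hlincomb_apply hmult_hconst sum_distrib_left mult_ac fun_eq_iff)

lemma hlincomb_unit_vec:
  assumes "j < n"
  shows "hlincomb n Y (unit_vec n j) = Y j"
proof
  fix q
  have "hlincomb n Y (unit_vec n j) q = (\<Sum>i<n. if i = j then Y j q else 0)"
    unfolding hlincomb_apply using assms by (intro sum.cong) auto
  then show "hlincomb n Y (unit_vec n j) q = Y j q" using assms by simp
qed

lemma hlincomb_mult_mat_vec: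
  assumes "C \<in> carrier_mat n l" "v \<in> carrier_vec l"
  shows "hlincomb n Y (C *\<^sub>v v) = hlincomb l (\<lambda>j. hlincomb n Y (col C j)) v"
proof
  fix q
  have "hlincomb n Y (C *\<^sub>v v) q = (\<Sum>i<n. \<Sum>j<l. C $$ (i, j) * v $ j * Y i q)"
    using assms by (simp add: hlincomb_apply scalar_prod_def lessThan_atLeast0 sum_distrib_right)
  also have "\<dots> = (\<Sum>j<l. \<Sum>i<n. C $$ (i, j) * v $ j * Y i q)"
    by (rule sum.swap)
  also have "\<dots> = hlincomb l (\<lambda>j. hlincomb n Y (col C j)) v q"
    using assms by (simp add: hlincomb_apply sum_distrib_left mult_ac)
  finally show "hlincomb n Y (C *\<^sub>v v) q = hlincomb l (\<lambda>j. hlincomb n Y (col C j)) v q" .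
qed

lemma hderiv_hlincomb: "hderiv (hlincomb n Y v) = hlincomb n (\<lambda>i. hderiv (Y i)) v"
  by (auto simp: hderiv_def hlincomb_apply)

lemma hderiv_hlincomb_change_basis:
  assumes T: "T \<in> GLm n UNIV" and J: "J \<in> carrier_mat n n" and v: "v \<in> carrier_vec n"
    and deriv: "\<And>q. q < n \<Longrightarrow>
      hderiv (hlincomb n Y (col T q)) = hlincomb n (\<lambda>p. hlincomb n Y (col T p)) (col J q)"
  shows "hderiv (hlincomb n Y v) = hlincomb n Y (T * J * inv_matrix n T *\<^sub>v v)"
proof -
  let ?Z = "\<lambda>p. hlincomb n Y (col T p)" and ?u = "inv_matrix n T *\<^sub>v v"
  note carriers = GLm_carrier[OF T] inv_matrix_carrier[OF T]
  have u: "?u \<in> carrier_vec n" "J *\<^sub>v ?u \<in> carrier_vec n"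
    using carriers J v by (auto intro: mult_mat_vec_carrier)
  have "v = T *\<^sub>v ?u"
    using assoc_mult_mat_vec[OF carriers v] mult_inv_matrix[OF T] v by simp
  then have "hderiv (hlincomb n Y v) = hderiv (hlincomb n Y (T *\<^sub>v ?u))" by simp
  also have "\<dots> = hlincomb n (\<lambda>q. hderiv (?Z q)) ?u"
    by (simp add: hlincomb_mult_mat_vec[OF carriers(1) u(1)] hderiv_hlincomb)
  also have "\<dots> = hlincomb n (\<lambda>q. hlincomb n ?Z (col J q)) ?u"
    by (rule hlincomb_cong[OF deriv])
  also have "\<dots> = hlincomb n Y (T *\<^sub>v (J *\<^sub>v ?u))"
    by (simp add: hlincomb_mult_mat_vec[OF carriers(1) u(2)] hlincomb_mult_mat_vec[OF J u(1)])
  also have "T *\<^sub>v (J *\<^sub>v ?u) = T * J * inv_matrix n T *\<^sub>v v"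
    using carriers J v u by (simp add: assoc_mult_mat_vec[of _ n n _ n] mult_carrier_mat[of _ n n _ n])
  finally show ?thesis .
qed

lemma hmult_hdivpow_hexp: "hmult (hdivpow j) (hexp \<beta>) q = of_nat (q choose j) * \<beta> ^ (q - j)"
proof -
  have "hmult (hdivpow j) (hexp \<beta>) q
      = (\<Sum>i\<le>q. if i = j then of_nat (q choose j) * \<beta> ^ (q - j) else 0)"
    unfolding hmult_def hdivpow_def hexp_def by (rule sum.cong) auto
  then show ?thesis by (auto simp: binomial_eq_0)
qed

lemma hmult_hdivpow_0_hexp_0: "hmult (hdivpow 0) (hexp 0) = hconst 1"
  by (auto simp: hmult_hdivpow_hexp hconst_def power_0_left)

lemma hderiv_hmult_hdivpow_hexp:
  "hderiv (hmult (hdivpow j) (hexp \<beta>)) q = \<beta> * hmult (hdivpow j) (hexp \<beta>) q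
    + (if 0 < j then hmult (hdivpow (j - 1)) (hexp \<beta>) q else 0)"
proof (cases j)
  case (Suc i)
  have "of_nat (q choose Suc i) * \<beta> ^ (q - i) = \<beta> * (of_nat (q choose Suc i) * \<beta> ^ (q - Suc i))"
  proof (cases "Suc i \<le> q")
    case True
    then have "q - i = Suc (q - Suc i)" by simp
    then show ?thesis by simp
  qed (simp add: binomial_eq_0)
  then show ?thesis using Suc by (simp add: hderiv_def hmult_hdivpow_hexp algebra_simps)
qed (simp add: hderiv_def hmult_hdivpow_hexp)

lemma hlincomb_col_diag_block_mat:
  assumes As: "square_blocks d As" and N: "N = (\<Sum>t<length As. d t)"
    and t: "t < length As" and j: "j < d t"
  shows "hlincomb N Z (col (diag_block_mat As) (block_index d t j))
    = hlincomb (d t) (\<lambda>i. Z (block_index d t i)) (col (As ! t) j)"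
proof
  fix q
  have "block_index d t j < N" unfolding N using t j by (rule block_index_less)
  then have "hlincomb N Z (col (diag_block_mat As) (block_index d t j)) q
      = (\<Sum>p<N. Z p q * diag_block_mat As $$ (p, block_index d t j))"
    using diag_block_mat_carrier[OF As, folded N] by (simp add: hlincomb_apply mult.commute)
  also have "\<dots> = hlincomb (d t) (\<lambda>i. Z (block_index d t i)) (col (As ! t) j) q"
    using j square_blocksD[OF As t]
    by (simp add: sum_mult_diag_block_mat_col[OF As N t j] hlincomb_apply mult.commute)
  finally show "hlincomb N Z (col (diag_block_mat As) (block_index d t j)) q
      = hlincomb (d t) (\<lambda>i. Z (block_index d t i)) (col (As ! t) j) q" .
qed

lemma hlincomb_col_jordan_block:
  assumes "j < l"
  shows "hlincomb l Z (col (jordan_block l \<beta>) j) q = \<beta> * Z j q + (if 0 < j then Z (j - 1) q else 0)"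
  using sum_mult_jordan_block_col[OF assms, of "\<lambda>i. Z i q" \<beta>] assms
  by (simp add: hlincomb_apply mult.commute)

lemma hderiv_eq_hlincomb_col_jordan_blocks:
  assumes Z: "\<And>t j. t < r \<Longrightarrow> j < d t \<Longrightarrow> Z (block_index d t j) = hmult (hdivpow j) (hexp (\<alpha> t))"
    and N: "N = (\<Sum>t<r. d t)" and "p < N"
  shows "hderiv (Z p) = hlincomb N Z (col (diag_block_mat (jordan_blocks r d \<alpha>)) p)"
proof -
  obtain t j where t: "t < r" "j < d t" and p: "p = block_index d t j"
    using \<open>p < N\<close> unfolding N by (rule block_index_exists)
  have "hlincomb N Z (col (diag_block_mat (jordan_blocks r d \<alpha>)) p)
      = hlincomb (d t) (\<lambda>i. Z (block_index d t i)) (col (jordan_block (d t) (\<alpha> t)) j)"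
    using hlincomb_col_diag_block_mat[of d "jordan_blocks r d \<alpha>" N t j Z] t by (simp add: N p)
  then show ?thesis
    using t by (auto simp: hlincomb_col_jordan_block hderiv_hmult_hdivpow_hexp Z p)
qed

section \<open>Automorphisms of the solution space as matrices\<close>

function recurrence_solution :: "nat \<Rightarrow> (nat \<Rightarrow> 'a::field) \<Rightarrow> (nat \<Rightarrow> 'a) \<Rightarrow> nat \<Rightarrow> 'a" where
  "recurrence_solution n a b q =
    (if q < n then b q else - (\<Sum>i<n. a i * recurrence_solution n a b (q - n + i)))"
  by pat_completeness auto
termination by (relation "measure (\<lambda>(n, a, b, q). q)") auto

declare recurrence_solution.simps [simp del]

lemma Lop_recurrence_solution: "Lop n a (recurrence_solution n a b) = (\<lambda>_. 0)"
proof
  fix q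
  show "Lop n a (recurrence_solution n a b) q = 0"
    unfolding Lop_apply by (subst recurrence_solution.simps[of _ _ _ "q + n"]) simp
qed

lemma recurrence_solution_initial: "q < n \<Longrightarrow> recurrence_solution n a b q = b q"
  by (subst recurrence_solution.simps) simp

lemma solV_hderiv: "v \<in> solV k n a \<Longrightarrow> hderiv v \<in> solV k n a"
  by (simp add: solV_def Lop_hderiv) (simp add: hderiv_def)

lemma diff_aut_set_apply:
  assumes "\<sigma> \<in> diff_aut_set k V"
  shows diff_aut_mem: "v \<in> V \<Longrightarrow> \<sigma> v \<in> V"
    and diff_aut_hadd: "u \<in> V \<Longrightarrow> v \<in> V \<Longrightarrow> \<sigma> (hadd u v) = hadd (\<sigma> u) (\<sigma> v)"
    and diff_aut_scale: "c \<in> k \<Longrightarrow> v \<in> V \<Longrightarrow> \<sigma> (hmult (hconst c) v) = hmult (hconst c) (\<sigma> v)"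
  using assms by (auto simp: diff_aut_set_def dest: bij_betwE)

locale coefficient_field =
  fixes k :: "'K::field set"
  assumes is_subfield: "is_subfield k"
begin

lemma zero_mem: "0 \<in> k"
  and one_mem: "1 \<in> k"
  and add_mem: "x \<in> k \<Longrightarrow> y \<in> k \<Longrightarrow> x + y \<in> k"
  and mult_mem: "x \<in> k \<Longrightarrow> y \<in> k \<Longrightarrow> x * y \<in> k"
  and uminus_mem: "x \<in> k \<Longrightarrow> - x \<in> k"
  using is_subfield by (simp_all add: is_subfield_def)

lemma sum_mem: "(\<And>i. i \<in> I \<Longrightarrow> f i \<in> k) \<Longrightarrow> sum f I \<in> k"
  by (induction I rule: infinite_finite_induct) (auto intro: zero_mem add_mem)

lemma unit_vec_mem_vecs_over: "unit_vec n j \<in> vecs_over k n"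
  by (auto simp: vecs_over_def unit_vec_def zero_mem one_mem)

lemma add_mem_vecs_over: "v \<in> vecs_over k n \<Longrightarrow> w \<in> vecs_over k n \<Longrightarrow> v + w \<in> vecs_over k n"
  by (auto simp: vecs_over_def add_mem)

lemma smult_mem_vecs_over: "c \<in> k \<Longrightarrow> v \<in> vecs_over k n \<Longrightarrow> c \<cdot>\<^sub>v v \<in> vecs_over k n"
  by (auto simp: vecs_over_def mult_mem)

lemma mult_mat_vec_mem_vecs_over:
  "C \<in> mats_over k n \<Longrightarrow> v \<in> vecs_over k n \<Longrightarrow> C *\<^sub>v v \<in> vecs_over k n"
  by (auto simp: vecs_over_def mats_over_def scalar_prod_def intro!: sum_mem mult_mem)

lemma bij_betw_mult_mat_vec_iff:
  assumes C: "C \<in> mats_over k n"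
  shows "bij_betw ((*\<^sub>v) C) (vecs_over k n) (vecs_over k n) \<longleftrightarrow> C \<in> GLm n k"
proof
  assume "bij_betw ((*\<^sub>v) C) (vecs_over k n) (vecs_over k n)"
  then have "unit_vec n j \<in> (*\<^sub>v) C ` vecs_over k n" for j
    using unit_vec_mem_vecs_over by (auto simp: bij_betw_def)
  then have "\<exists>c\<in>vecs_over k n. C *\<^sub>v c = unit_vec n j" for j by (metis imageE)
  then show "C \<in> GLm n k" by (intro unit_vecs_image_imp_GLm[OF C]) auto
next
  assume GL: "C \<in> GLm n k"
  then obtain D where D: "D \<in> mats_over k n" "C * D = 1\<^sub>m n" "D * C = 1\<^sub>m n"
    by (auto simp: GLm_def mats_over_def)
  note carriers = mats_over_carrier[OF C] mats_over_carrier[OF D(1)]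
  show "bij_betw ((*\<^sub>v) C) (vecs_over k n) (vecs_over k n)"
  proof (rule bij_betw_byWitness[where f' = "(*\<^sub>v) D"])
    show "\<forall>v\<in>vecs_over k n. D *\<^sub>v (C *\<^sub>v v) = v" "\<forall>v\<in>vecs_over k n. C *\<^sub>v (D *\<^sub>v v) = v"
      using D(2,3) by (simp_all flip: assoc_mult_mat_vec[OF carriers] assoc_mult_mat_vec[OF carriers(2,1)]
          add: vecs_over_carrier)
  qed (use C D(1) mult_mat_vec_mem_vecs_over in auto)
qed

lemma solV_hadd: "u \<in> solV k n a \<Longrightarrow> v \<in> solV k n a \<Longrightarrow> hadd u v \<in> solV k n a"
  by (simp add: solV_def Lop_hadd) (simp add: hadd_def add_mem)

lemma solV_scale: "c \<in> k \<Longrightarrow> v \<in> solV k n a \<Longrightarrow> hmult (hconst c) v \<in> solV k n a"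
  by (simp add: solV_def Lop_scale) (simp add: hmult_hconst mult_mem)

lemma solV_zero: "(\<lambda>_. 0) \<in> solV k n a"
  by (auto simp: solV_def Lop_apply zero_mem)

lemma hconst_mem_solV:
  assumes "c \<in> k" "n \<ge> 1" "a 0 = 0"
  shows "hconst c \<in> solV k n a"
proof -
  have "Lop n a (hconst c) q = 0" for q
    using assms(2,3) by (auto simp: Lop_apply hconst_def intro!: sum.neutral)
  then show ?thesis using assms(1) zero_mem by (auto simp: solV_def hconst_def)
qed

lemma solV_hsum:
  assumes "finite I" "\<And>i. i \<in> I \<Longrightarrow> c i \<in> k" "\<And>i. i \<in> I \<Longrightarrow> y i \<in> solV k n a"
  shows "hsum (\<lambda>i. hmult (hconst (c i)) (y i)) I \<in> solV k n a"
  using assms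
  by (induction I rule: finite_induct)
    (auto simp: hsum_empty hsum_insert solV_zero intro: solV_hadd solV_scale)

lemma solV_hlincomb:
  "v \<in> vecs_over k n \<Longrightarrow> (\<And>i. i < n \<Longrightarrow> Y i \<in> solV k n a) \<Longrightarrow> hlincomb n Y v \<in> solV k n a"
  unfolding hlincomb_def by (rule solV_hsum) (auto simp: vecs_over_def)

lemma diff_aut_hsum:
  assumes \<sigma>: "\<sigma> \<in> diff_aut_set k (solV k n a)"
    and "finite I" "\<And>i. i \<in> I \<Longrightarrow> c i \<in> k" "\<And>i. i \<in> I \<Longrightarrow> y i \<in> solV k n a"
  shows "\<sigma> (hsum (\<lambda>i. hmult (hconst (c i)) (y i)) I) = hsum (\<lambda>i. hmult (hconst (c i)) (\<sigma> (y i))) I"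
  using assms(2-)
proof (induction I rule: finite_induct)
  case empty
  have "\<sigma> (hmult (hconst 0) (\<lambda>_. 0)) = hmult (hconst 0) (\<sigma> (\<lambda>_. 0))"
    by (rule diff_aut_scale[OF \<sigma> zero_mem solV_zero])
  then show ?case by (simp add: hsum_empty hmult_hconst)
next
  case (insert i I)
  have "\<sigma> (hsum (\<lambda>i. hmult (hconst (c i)) (y i)) (insert i I))
      = \<sigma> (hadd (hmult (hconst (c i)) (y i)) (hsum (\<lambda>i. hmult (hconst (c i)) (y i)) I))"
    using insert.hyps by (simp add: hsum_insert)
  also have "\<dots> = hadd (\<sigma> (hmult (hconst (c i)) (y i))) (\<sigma> (hsum (\<lambda>i. hmult (hconst (c i)) (y i)) I))"
    using insert.hyps insert.prems by (intro diff_aut_hadd[OF \<sigma>] solV_scale solV_hsum) auto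
  also have "\<sigma> (hmult (hconst (c i)) (y i)) = hmult (hconst (c i)) (\<sigma> (y i))"
    using insert.prems by (intro diff_aut_scale[OF \<sigma>]) auto
  finally show ?case using insert by (simp add: hsum_insert)
qed

end

locale hurwitz_basis = coefficient_field k for k :: "'a::field set" +
  fixes n :: nat and a :: "nat \<Rightarrow> 'a" and Y :: "nat \<Rightarrow> 'a hurwitz"
  assumes coeffs: "\<forall>i<n. a i \<in> k"
    and basis: "is_basis_over k (solV k n a) n Y"
begin

abbreviation V :: "'a hurwitz set" where "V \<equiv> solV k n a"

lemma basis_mem: "i < n \<Longrightarrow> Y i \<in> V"
  using basis by (simp add: is_basis_over_def)

lemma one_mem_V: "n \<ge> 1 \<Longrightarrow> a 0 = 0 \<Longrightarrow> hconst 1 \<in> V"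
  using one_mem by (rule hconst_mem_solV)

lemma hlincomb_mem: "v \<in> vecs_over k n \<Longrightarrow> hlincomb n Y v \<in> V"
  using basis_mem by (intro solV_hlincomb) auto

lemma coordinates_exist:
  assumes "v \<in> V"
  obtains c where "c \<in> vecs_over k n" "v = hlincomb n Y c"
proof -
  obtain c where "\<forall>i<n. c i \<in> k" "v = hsum (\<lambda>i. hmult (hconst (c i)) (Y i)) {..<n}"
    using basis assms unfolding is_basis_over_def by blast
  then show ?thesis using that[of "vec n c"] by (simp add: hsum_eq_hlincomb vecs_over_def)
qed

lemma recurrence_solution_mem_V:
  assumes b: "\<And>q. b q \<in> k"
  shows "recurrence_solution n a b \<in> V"
proof -
  have "recurrence_solution n a b q \<in> k" for q
  proof (induction q rule: less_induct)
    case (less q)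
    have "(\<Sum>i<n. a i * recurrence_solution n a b (q - n + i)) \<in> k" if "\<not> q < n"
      using that less coeffs by (intro sum_mem mult_mem) auto
    then show ?case using b by (subst recurrence_solution.simps) (auto intro: uminus_mem)
  qed
  then show ?thesis by (simp add: solV_def Lop_recurrence_solution)
qed

definition initial_values_mat :: "'a mat" where
  "initial_values_mat = mat n n (\<lambda>(q, i). Y i q)"

lemma initial_values_mat_mult_vec:
  "v \<in> carrier_vec n \<Longrightarrow> initial_values_mat *\<^sub>v v = vec n (hlincomb n Y v)"
  by (intro eq_vecI)
    (auto simp: initial_values_mat_def hlincomb_apply scalar_prod_def lessThan_atLeast0 mult.commute)

lemma initial_values_mat_mem_GLm: "initial_values_mat \<in> GLm n k"
proof (rule unit_vecs_image_imp_GLm)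
  show "initial_values_mat \<in> mats_over k n"
    using basis_mem by (auto simp: initial_values_mat_def mats_over_def solV_def)
  fix j assume "j < n"
  let ?u = "recurrence_solution n a (\<lambda>q. if q = j then 1 else 0)"
  have "?u \<in> V" by (rule recurrence_solution_mem_V) (simp add: zero_mem one_mem)
  then obtain c where c: "c \<in> vecs_over k n" "?u = hlincomb n Y c" by (rule coordinates_exist)
  then have "initial_values_mat *\<^sub>v c = vec n ?u"
    by (simp add: initial_values_mat_mult_vec vecs_over_carrier)
  also have "\<dots> = unit_vec n j"
    by (auto simp: recurrence_solution_initial unit_vec_def)
  finally show "\<exists>c\<in>vecs_over k n. initial_values_mat *\<^sub>v c = unit_vec n j" using c(1) by blast
qed

text \<open>The invertibility of the matrix of initial values makes \<open>Y\<close> independent over the whole field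
  and not just over \<open>k\<close>.\<close>

lemma hlincomb_inject:
  assumes v: "v \<in> carrier_vec n" and w: "w \<in> carrier_vec n"
  shows "hlincomb n Y v = hlincomb n Y w \<longleftrightarrow> v = w"
proof
  assume "hlincomb n Y v = hlincomb n Y w"
  then have "initial_values_mat *\<^sub>v v = initial_values_mat *\<^sub>v w"
    using v w by (simp add: initial_values_mat_mult_vec)
  then show "v = w" using v w initial_values_mat_mem_GLm by (simp add: GLm_mult_mat_vec_cancel)
qed simp

lemma hlincomb_mem_iff: "v \<in> carrier_vec n \<Longrightarrow> hlincomb n Y v \<in> V \<longleftrightarrow> v \<in> vecs_over k n"
  by (metis coordinates_exist hlincomb_inject hlincomb_mem vecs_over_carrier)

lemma bij_betw_hlincomb: "bij_betw (hlincomb n Y) (vecs_over k n) V"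
proof (rule bij_betw_imageI)
  show "inj_on (hlincomb n Y) (vecs_over k n)"
    by (auto intro!: inj_onI simp: hlincomb_inject vecs_over_carrier)
  show "hlincomb n Y ` vecs_over k n = V"
    using hlincomb_mem by (auto elim: coordinates_exist)
qed

definition represents :: "'a mat \<Rightarrow> ('a hurwitz \<Rightarrow> 'a hurwitz) \<Rightarrow> bool" where
  "represents C f \<longleftrightarrow> C \<in> mats_over k n \<and> (\<forall>v\<in>vecs_over k n. f (hlincomb n Y v) = hlincomb n Y (C *\<^sub>v v))"

lemma represents_mats_over: "represents C f \<Longrightarrow> C \<in> mats_over k n"
  by (simp add: represents_def)

lemma represents_carrier: "represents C f \<Longrightarrow> C \<in> carrier_mat n n"
  by (rule mats_over_carrier[OF represents_mats_over])

lemma represents_hlincomb: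
  "represents C f \<Longrightarrow> v \<in> vecs_over k n \<Longrightarrow> f (hlincomb n Y v) = hlincomb n Y (C *\<^sub>v v)"
  by (simp add: represents_def)

lemma representsI:
  assumes C: "C \<in> carrier_mat n n" and maps: "\<And>v. v \<in> V \<Longrightarrow> f v \<in> V"
    and apply_f: "\<And>v. v \<in> vecs_over k n \<Longrightarrow> f (hlincomb n Y v) = hlincomb n Y (C *\<^sub>v v)"
  shows "represents C f"
proof -
  have "C *\<^sub>v v \<in> vecs_over k n" if "v \<in> vecs_over k n" for v
    using that maps[OF hlincomb_mem[OF that]] apply_f[OF that] C hlincomb_mem_iff[of "C *\<^sub>v v"]
      mult_mat_vec_carrier[OF C vecs_over_carrier] by simp
  then have "C \<in> mats_over k n"
    using C unit_vec_mem_vecs_over by (metis mem_mats_over_iff_col mult_mat_unit_vec)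
  then show ?thesis using apply_f by (simp add: represents_def)
qed

lemma represents_mem:
  assumes C: "represents C f" and "v \<in> V"
  shows "f v \<in> V"
proof -
  obtain c where c: "c \<in> vecs_over k n" "v = hlincomb n Y c"
    using \<open>v \<in> V\<close> by (rule coordinates_exist)
  then show ?thesis
    using hlincomb_mem mult_mat_vec_mem_vecs_over[OF represents_mats_over[OF C]]
    by (simp add: represents_hlincomb[OF C])
qed

lemma represents_compose:
  assumes C: "represents C f" and D: "represents D g"
  shows "represents (C * D) (compose V f g)"
proof (rule representsI)
  note carriers = represents_carrier[OF C] represents_carrier[OF D]
  show "C * D \<in> carrier_mat n n" using carriers by (rule mult_carrier_mat)
  show "compose V f g v \<in> V" if "v \<in> V" for v
    using that C D by (simp add: compose_def represents_mem)
  fix v assume v: "v \<in> vecs_over k n"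
  have "compose V f g (hlincomb n Y v) = hlincomb n Y (C *\<^sub>v (D *\<^sub>v v))"
    using v mult_mat_vec_mem_vecs_over[OF represents_mats_over[OF D] v]
    by (simp add: compose_def hlincomb_mem represents_hlincomb[OF C] represents_hlincomb[OF D])
  then show "compose V f g (hlincomb n Y v) = hlincomb n Y (C * D *\<^sub>v v)"
    by (simp add: assoc_mult_mat_vec[OF carriers vecs_over_carrier[OF v]])
qed

lemma represented_map_unique:
  assumes f: "represents C f" "f \<in> extensional V" and g: "represents C g" "g \<in> extensional V"
  shows "f = g"
proof (rule extensionalityI[OF f(2) g(2)])
  fix v assume "v \<in> V"
  then obtain c where "c \<in> vecs_over k n" "v = hlincomb n Y c" by (rule coordinates_exist)
  then show "f v = g v" by (simp add: represents_hlincomb[OF f(1)] represents_hlincomb[OF g(1)])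
qed

lemma represented_map_exists:
  assumes C: "C \<in> mats_over k n"
  obtains f where "represents C f" "f \<in> extensional V"
proof
  define f where "f = restrict (\<lambda>v. hlincomb n Y (C *\<^sub>v inv_into (vecs_over k n) (hlincomb n Y) v)) V"
  show "f \<in> extensional V" by (simp add: f_def)
  show "represents C f"
    using C bij_betw_inv_into_left[OF bij_betw_hlincomb]
    by (auto simp: represents_def f_def hlincomb_mem)
qed

lemma Cmat_eqI:
  assumes C: "represents C \<sigma>"
  shows "Cmat k n Y \<sigma> = C"
  unfolding Cmat_def
proof (rule the_equality)
  have \<sigma>_Y: "\<sigma> (Y j) = hlincomb n Y (col C j)" if "j < n" for j
    using represents_hlincomb[OF C unit_vec_mem_vecs_over, of j] that
    by (simp add: hlincomb_unit_vec mult_mat_unit_vec[OF represents_carrier[OF C]])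
  then show "C \<in> carrier_mat n n \<and> (\<forall>i<n. \<forall>j<n. C $$ (i, j) \<in> k) \<and>
      (\<forall>j<n. \<sigma> (Y j) = hsum (\<lambda>i. hmult (hconst (C $$ (i, j))) (Y i)) {..<n})"
    using represents_mats_over[OF C] hlincomb_col[of C n n] by (simp add: mats_over_def)
  fix D assume D: "D \<in> carrier_mat n n \<and> (\<forall>i<n. \<forall>j<n. D $$ (i, j) \<in> k) \<and>
      (\<forall>j<n. \<sigma> (Y j) = hsum (\<lambda>i. hmult (hconst (D $$ (i, j))) (Y i)) {..<n})"
  have "col D j = col C j" if "j < n" for j
  proof -
    have "hlincomb n Y (col D j) = hlincomb n Y (col C j)"
      using D hlincomb_col[of D n n j] \<sigma>_Y that by simp
    then show ?thesis
      using D represents_carrier[OF C] by (subst (asm) hlincomb_inject) auto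
  qed
  then show "D = C"
    using D represents_carrier[OF C] by (intro mat_col_eqI) auto
qed

lemma diff_aut_represented:
  assumes \<sigma>: "\<sigma> \<in> diff_aut_set k V"
  shows "represents (Cmat k n Y \<sigma>) \<sigma>"
proof -
  have "\<exists>c\<in>vecs_over k n. \<sigma> (Y j) = hlincomb n Y c" if "j < n" for j
    using coordinates_exist[OF diff_aut_mem[OF \<sigma> basis_mem[OF that]]] by metis
  then obtain C where C: "C \<in> mats_over k n" and \<sigma>_Y: "\<And>j. j < n \<Longrightarrow> \<sigma> (Y j) = hlincomb n Y (col C j)"
    by (rule exists_mat_over_cols) blast+
  have "\<sigma> (hlincomb n Y v) = hlincomb n Y (C *\<^sub>v v)" if v: "v \<in> vecs_over k n" for v
  proof -
    have "\<sigma> (hlincomb n Y v) = hlincomb n (\<lambda>j. \<sigma> (Y j)) v"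
      unfolding hlincomb_def using v basis_mem by (intro diff_aut_hsum[OF \<sigma>]) (auto simp: vecs_over_def)
    also have "\<dots> = hlincomb n (\<lambda>j. hlincomb n Y (col C j)) v" by (rule hlincomb_cong[OF \<sigma>_Y])
    finally show ?thesis
      by (simp add: hlincomb_mult_mat_vec[OF mats_over_carrier[OF C] vecs_over_carrier[OF v]])
  qed
  then have "represents C \<sigma>" using C by (simp add: represents_def)
  then show ?thesis using Cmat_eqI by metis
qed

lemma represented_hadd:
  assumes C: "represents C f" and "u \<in> V" "v \<in> V"
  shows "f (hadd u v) = hadd (f u) (f v)"
proof -
  obtain c d where c: "c \<in> vecs_over k n" "u = hlincomb n Y c"
    and d: "d \<in> vecs_over k n" "v = hlincomb n Y d"
    using assms(2,3) by (metis coordinates_exist)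
  have "f (hadd u v) = hlincomb n Y (C *\<^sub>v (c + d))"
    using c d represents_hlincomb[OF C add_mem_vecs_over] by (simp add: hlincomb_add vecs_over_carrier)
  also have "C *\<^sub>v (c + d) = C *\<^sub>v c + C *\<^sub>v d"
    using c d
    by (intro mult_add_distrib_mat_vec[OF represents_carrier[OF C]]) (auto simp: vecs_over_carrier)
  finally show ?thesis
    using c d represents_carrier[OF C]
    by (simp add: hlincomb_add vecs_over_carrier represents_hlincomb[OF C]
        mult_mat_vec_carrier[of C n n])
qed

lemma represented_scale:
  assumes C: "represents C f" and "x \<in> k" "v \<in> V"
  shows "f (hmult (hconst x) v) = hmult (hconst x) (f v)"
proof -
  obtain c where c: "c \<in> vecs_over k n" "v = hlincomb n Y c"
    using \<open>v \<in> V\<close> by (rule coordinates_exist)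
  have "f (hmult (hconst x) v) = hlincomb n Y (C *\<^sub>v (x \<cdot>\<^sub>v c))"
    using c represents_hlincomb[OF C smult_mem_vecs_over[OF \<open>x \<in> k\<close>]]
    by (simp add: hlincomb_smult vecs_over_carrier)
  also have "C *\<^sub>v (x \<cdot>\<^sub>v c) = x \<cdot>\<^sub>v (C *\<^sub>v c)"
    by (rule mult_mat_vec[OF represents_carrier[OF C] vecs_over_carrier[OF c(1)]])
  finally show ?thesis
    using c represents_carrier[OF C]
    by (simp add: hlincomb_smult vecs_over_carrier represents_hlincomb[OF C]
        mult_mat_vec_carrier[of C n n])
qed

lemma represented_bij_betw_iff:
  assumes C: "represents C f"
  shows "bij_betw f V V \<longleftrightarrow> C \<in> GLm n k"
proof -
  let ?W = "vecs_over k n"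
  have maps: "(*\<^sub>v) C ` ?W \<subseteq> ?W"
    using mult_mat_vec_mem_vecs_over[OF represents_mats_over[OF C]] by auto
  have "bij_betw f V V \<longleftrightarrow> bij_betw (f \<circ> hlincomb n Y) ?W V"
    by (rule bij_betw_comp_iff[OF bij_betw_hlincomb])
  also have "\<dots> \<longleftrightarrow> bij_betw (hlincomb n Y \<circ> (*\<^sub>v) C) ?W V"
    by (rule bij_betw_cong) (simp add: represents_hlincomb[OF C])
  also have "\<dots> \<longleftrightarrow> bij_betw ((*\<^sub>v) C) ?W ?W"
    by (rule bij_betw_comp_iff2[OF bij_betw_hlincomb maps, symmetric])
  also have "\<dots> \<longleftrightarrow> C \<in> GLm n k"
    by (rule bij_betw_mult_mat_vec_iff[OF represents_mats_over[OF C]])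
  finally show ?thesis .
qed

lemma represented_eq_iff:
  assumes "represents C f" "represents D g"
  shows "(\<forall>v\<in>V. f v = g v) \<longleftrightarrow> C = D"
proof -
  have "(\<forall>v\<in>V. f v = g v) \<longleftrightarrow> (\<forall>c\<in>vecs_over k n. f (hlincomb n Y c) = g (hlincomb n Y c))"
    by (metis coordinates_exist hlincomb_mem)
  also have "\<dots> \<longleftrightarrow> (\<forall>c\<in>vecs_over k n. C *\<^sub>v c = D *\<^sub>v c)"
    using assms by (simp add: represents_hlincomb hlincomb_inject vecs_over_carrier
        mult_mat_vec_carrier[OF represents_carrier[OF assms(1)]]
        mult_mat_vec_carrier[OF represents_carrier[OF assms(2)]])
  also have "\<dots> \<longleftrightarrow> C = D"
    using eq_mat_unit_vecI[OF assms[THEN represents_carrier]] unit_vec_mem_vecs_over by auto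
  finally show ?thesis .
qed

lemma represented_commute_iff:
  assumes C: "represents C f" and A: "represents A g"
  shows "(\<forall>v\<in>V. f (g v) = g (f v)) \<longleftrightarrow> A * C = C * A"
  using represented_eq_iff[OF represents_compose[OF C A] represents_compose[OF A C]]
  by (auto simp: compose_def)

lemma represented_fixes_constants_iff:
  assumes C: "represents C f" and one: "hconst 1 \<in> V"
    and w: "w \<in> carrier_vec n" "hlincomb n Y w = hconst 1"
  shows "(\<forall>c\<in>k. hconst c \<in> V \<longrightarrow> f (hconst c) = hconst c) \<longleftrightarrow> C *\<^sub>v w = w"
proof -
  have w_mem: "w \<in> vecs_over k n" using one w hlincomb_mem_iff by metis
  have hconst_eq: "hconst c = hmult (hconst c) (hconst 1)" for c :: 'a
    by (simp add: hmult_hconst) (simp add: hconst_def fun_eq_iff)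
  have "(\<forall>c\<in>k. hconst c \<in> V \<longrightarrow> f (hconst c) = hconst c) \<longleftrightarrow> f (hconst 1) = hconst 1"
    using one one_mem represented_scale[OF C _ one] by (metis hconst_eq)
  also have "\<dots> \<longleftrightarrow> hlincomb n Y (C *\<^sub>v w) = hlincomb n Y w"
    using represents_hlincomb[OF C w_mem] w by simp
  also have "\<dots> \<longleftrightarrow> C *\<^sub>v w = w"
    using w mult_mat_vec_carrier[OF represents_carrier[OF C] w(1)] by (intro hlincomb_inject)
  finally show ?thesis .
qed

lemma represented_mem_diff_aut_set_iff:
  assumes C: "represents C \<sigma>" and "\<sigma> \<in> extensional V"
    and A: "represents A hderiv" and one: "hconst 1 \<in> V"
    and w: "w \<in> carrier_vec n" "hlincomb n Y w = hconst 1"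
  shows "\<sigma> \<in> diff_aut_set k V \<longleftrightarrow> C \<in> GLm n k \<inter> centralizer_stabilizer n A w"
proof -
  have "\<sigma> \<in> diff_aut_set k V \<longleftrightarrow> bij_betw \<sigma> V V \<and> (\<forall>v\<in>V. \<sigma> (hderiv v) = hderiv (\<sigma> v)) \<and>
      (\<forall>c\<in>k. hconst c \<in> V \<longrightarrow> \<sigma> (hconst c) = hconst c)"
    using \<open>\<sigma> \<in> extensional V\<close> represented_hadd[OF C] represented_scale[OF C]
    by (auto simp: diff_aut_set_def)
  also have "\<dots> \<longleftrightarrow> C \<in> GLm n k \<and> A * C = C * A \<and> C *\<^sub>v w = w"
    using represented_bij_betw_iff[OF C] represented_commute_iff[OF C A]
      represented_fixes_constants_iff[OF C one w] by simp
  also have "\<dots> \<longleftrightarrow> C \<in> GLm n k \<inter> centralizer_stabilizer n A w"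
    using GLm_subset_UNIV by (auto simp: centralizer_stabilizer_def centralizer_def)
  finally show ?thesis .
qed

lemma bij_betw_Cmat:
  assumes A: "represents A hderiv" and one: "hconst 1 \<in> V"
    and w: "w \<in> carrier_vec n" "hlincomb n Y w = hconst 1"
  shows "bij_betw (Cmat k n Y) (diff_aut_set k V) (GLm n k \<inter> centralizer_stabilizer n A w)"
proof (rule bij_betw_imageI)
  have ext: "\<sigma> \<in> extensional V" if "\<sigma> \<in> diff_aut_set k V" for \<sigma>
    using that by (simp add: diff_aut_set_def)
  show "inj_on (Cmat k n Y) (diff_aut_set k V)"
    by (rule inj_onI) (metis diff_aut_represented ext represented_map_unique)
  show "Cmat k n Y ` diff_aut_set k V = GLm n k \<inter> centralizer_stabilizer n A w"
  proof (intro equalityI subsetI)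
    fix C assume "C \<in> Cmat k n Y ` diff_aut_set k V"
    then show "C \<in> GLm n k \<inter> centralizer_stabilizer n A w"
      using represented_mem_diff_aut_set_iff[OF diff_aut_represented ext A one w] by blast
  next
    fix C assume C: "C \<in> GLm n k \<inter> centralizer_stabilizer n A w"
    then obtain \<sigma> where \<sigma>: "represents C \<sigma>" "\<sigma> \<in> extensional V"
      using represented_map_exists GLm_subset_mats_over by blast
    then have "\<sigma> \<in> diff_aut_set k V" using C represented_mem_diff_aut_set_iff[OF _ _ A one w] by blast
    then show "C \<in> Cmat k n Y ` diff_aut_set k V" using Cmat_eqI[OF \<sigma>(1)] by blast
  qed
qed

lemma represents_hderiv_if_exponential_cols:
  assumes T: "T \<in> GLm n UNIV" and n: "n = (\<Sum>t<r. d t)"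
    and exponential: "\<And>t j. t < r \<Longrightarrow> j < d t \<Longrightarrow>
      hlincomb n Y (col T (block_index d t j)) = hmult (hdivpow j) (hexp (\<alpha> t))"
  shows "represents (T * diag_block_mat (jordan_blocks r d \<alpha>) * inv_matrix n T) hderiv"
proof (rule representsI)
  let ?J = "diag_block_mat (jordan_blocks r d \<alpha>)"
  have J: "?J \<in> carrier_mat n n"
    using diag_block_mat_carrier[OF square_blocks_jordan_blocks[of d r \<alpha>]] n by simp
  show "T * ?J * inv_matrix n T \<in> carrier_mat n n"
    by (rule mult_carrier_mat[OF mult_carrier_mat[OF GLm_carrier[OF T] J] inv_matrix_carrier[OF T]])
  fix v assume "v \<in> vecs_over k n"
  then show "hderiv (hlincomb n Y v) = hlincomb n Y (T * ?J * inv_matrix n T *\<^sub>v v)"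
    using hderiv_eq_hlincomb_col_jordan_blocks[of r d "\<lambda>p. hlincomb n Y (col T p)", OF exponential n]
    by (intro hderiv_hlincomb_change_basis[OF T J]) (auto simp: vecs_over_carrier)
qed (rule solV_hderiv)

lemma bij_betw_Cmat_if_exponential_cols:
  assumes T: "T \<in> GLm n UNIV" and n: "n = (\<Sum>t<r. d t)"
    and exponential: "\<And>t j. t < r \<Longrightarrow> j < d t \<Longrightarrow>
      hlincomb n Y (col T (block_index d t j)) = hmult (hdivpow j) (hexp (\<alpha> t))"
    and t0: "t0 < r" "\<alpha> t0 = 0" "0 < d t0" and one: "hconst 1 \<in> V"
  shows "bij_betw (Cmat k n Y) (diff_aut_set k V) (GLm n k \<inter> centralizer_stabilizer n
    (T * diag_block_mat (jordan_blocks r d \<alpha>) * inv_matrix n T) (T *\<^sub>v unit_vec n (block_index d t0 0)))"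
proof (rule bij_betw_Cmat[OF represents_hderiv_if_exponential_cols[OF T n exponential] one])
  have "block_index d t0 0 < n" unfolding n using t0(1,3) by (rule block_index_less)
  then show "hlincomb n Y (T *\<^sub>v unit_vec n (block_index d t0 0)) = hconst 1"
    using exponential[OF t0(1,3)] t0(2)
    by (simp add: mult_mat_unit_vec[OF GLm_carrier[OF T]] hmult_hdivpow_0_hexp_0)
qed (use mult_mat_vec_carrier[OF GLm_carrier[OF T]] in auto)

lemma Cmat_compose:
  assumes "\<sigma> \<in> diff_aut_set k V" "\<tau> \<in> diff_aut_set k V"
  shows "Cmat k n Y (compose V \<sigma> \<tau>) = Cmat k n Y \<sigma> * Cmat k n Y \<tau>"
  using assms by (intro Cmat_eqI represents_compose diff_aut_represented)

lemma Cmat_iso: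
  assumes T: "T \<in> GLm n UNIV" and d: "d = (\<lambda>t. Suc (m t))" and n: "n = (\<Sum>t<r. d t)"
    and exponential: "\<And>t j. t < r \<Longrightarrow> j < d t \<Longrightarrow>
      hlincomb n Y (col T (block_index d t j)) = hmult (hdivpow j) (hexp (\<alpha> t))"
    and inj: "inj_on \<alpha> {..<r}" and t0: "t0 < r" "\<alpha> t0 = 0" and one: "hconst 1 \<in> V"
  shows "Cmat k n Y \<in> iso (diff_aut_group k V) (target_group k n T r m \<alpha>)"
proof -
  have "bij_betw (Cmat k n Y) (diff_aut_set k V) (carrier (target_group k n T r m \<alpha>))"
    unfolding carrier_target_group[OF T d n inj t0]
    using t0 one by (intro bij_betw_Cmat_if_exponential_cols[OF T n exponential]) (auto simp: d)
  then show ?thesis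
    using Cmat_compose
    by (auto simp: iso_def hom_def diff_aut_group_def target_group_def dest: bij_betwE)
qed

end

section \<open>Roots of the characteristic polynomial\<close>

lemma size_proots_eq_degree:
  fixes p :: "'a::field poly"
  assumes closed: "\<forall>q :: 'a poly. degree q > 0 \<longrightarrow> (\<exists>x. poly q x = 0)"
  shows "size (proots p) = degree p"
proof (induction "degree p" arbitrary: p)
  case 0
  then show ?case using size_proots_le[of p] by simp
next
  case (Suc l)
  then obtain x where "poly p x = 0" using closed by (metis zero_less_Suc)
  then obtain q where q: "p = [:-x, 1:] * q" by (metis dvdE poly_eq_0_iff_dvd)
  then have "q \<noteq> 0" using Suc.hyps(2) by auto
  then have "degree p = Suc (degree q)" unfolding q by (subst degree_mult_eq) auto
  then show ?case using Suc q \<open>q \<noteq> 0\<close> by (simp add: proots_mult del: mult_pCons_left)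
qed

lemma sum_order_eq_degree:
  fixes p :: "'a::field poly"
  assumes closed: "\<forall>q :: 'a poly. degree q > 0 \<longrightarrow> (\<exists>x. poly q x = 0)"
    and "p \<noteq> 0" and roots: "bij_betw \<alpha> I {x. poly p x = 0}"
  shows "(\<Sum>t\<in>I. order (\<alpha> t) p) = degree p"
proof -
  have "(\<Sum>t\<in>I. order (\<alpha> t) p) = (\<Sum>x | poly p x = 0. order x p)"
    by (rule sum.reindex_bij_betw[OF roots])
  also have "\<dots> = size (proots p)"
    using \<open>p \<noteq> 0\<close> by (simp add: size_multiset_overloaded_eq)
  finally show ?thesis by (simp add: size_proots_eq_degree[OF closed])
qed

lemma charpoly_degree: "degree (charpoly n a) = n"
  and charpoly_nonzero: "charpoly n a \<noteq> 0"
proof -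
  have coeff_charpoly: "coeff (charpoly n a) i = (if i = n then 1 else if i < n then a i else 0)" for i
    by (auto simp: charpoly_def coeff_sum)
  show "degree (charpoly n a) = n"
    by (intro antisym degree_le le_degree) (simp_all add: coeff_charpoly)
  show "charpoly n a \<noteq> 0" using coeff_charpoly[of n] by auto
qed

lemma poly_charpoly_0: "n \<ge> 1 \<Longrightarrow> poly (charpoly n a) 0 = a 0"
  by (simp add: charpoly_def poly_monom poly_sum power_0_left if_distrib cong: if_cong)

theorem mainTheorem9:
  fixes k :: "'K::field set" and n r :: nat and a :: "nat \<Rightarrow> 'K"
    and \<alpha> :: "nat \<Rightarrow> 'K" and m :: "nat \<Rightarrow> nat"
    and Y :: "nat \<Rightarrow> 'K hurwitz" and T :: "'K mat"
  assumes closure: "is_algebraic_closure_of k"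
    and n: "n \<ge> 1"
    and a_k: "\<forall>i<n. a i \<in> k" and a0: "a 0 = 0"
    and roots_inj: "inj_on \<alpha> {..<r}"
    and roots: "\<alpha> ` {..<r} = {x. poly (charpoly n a) x = 0}"
    and mult: "\<forall>t<r. order (\<alpha> t) (charpoly n a) = Suc (m t)"
    and basis: "is_basis_over k (solV k n a) n Y"
    and T_GL: "T \<in> GLm n UNIV"
    and YT: "\<forall>t<r. \<forall>j\<le>m t.
         hmult (hdivpow j) (hexp (\<alpha> t))
       = hsum (\<lambda>i. hmult (hconst (T $$ (i, (\<Sum>s<t. Suc (m s)) + j))) (Y i)) {..<n}"
  shows "Cmat k n Y \<in> iso (diff_aut_group k (solV k n a)) (target_group k n T r m \<alpha>)"
proof -
  have hurwitz_basis: "hurwitz_basis k n a Y"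
    using closure a_k basis by unfold_locales (auto simp: is_algebraic_closure_of_def)
  define d where "d = (\<lambda>t. Suc (m t))"
  have n_eq: "n = (\<Sum>t<r. d t)"
    using sum_order_eq_degree[OF _ charpoly_nonzero bij_betw_imageI[OF roots_inj roots]] closure mult
    by (simp add: is_algebraic_closure_of_def charpoly_degree d_def)
  have "0 \<in> \<alpha> ` {..<r}" unfolding roots using n a0 by (simp add: poly_charpoly_0)
  then obtain t0 where t0: "t0 < r" "\<alpha> t0 = 0" by auto
  have exponential: "hlincomb n Y (col T (block_index d t j)) = hmult (hdivpow j) (hexp (\<alpha> t))"
    if "t < r" "j < d t" for t j
    using YT that hlincomb_col[OF GLm_carrier[OF T_GL], of "block_index d t j" Y]
      block_index_less[of t r j d] n_eq by (simp add: d_def block_index_def less_Suc_eq_le)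
  show ?thesis
    by (rule hurwitz_basis.Cmat_iso[OF hurwitz_basis T_GL d_def n_eq exponential roots_inj t0
          hurwitz_basis.one_mem_V[OF hurwitz_basis n a0]])
qed

end
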